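(* Let $(X,d,\ll,\leq,\tau)$ be a strongly causal Lorentzian length space that has property $(TC)$. Suppose that $X$ has an extension $(\tilde X,\tilde d,\tilde\ll,\tilde\leq,\tilde\tau)$ which is a strongly causal, locally timelike geodesically connected Lorentzian length space. Then this extension has a causal curvature singularity; specifically, $\tilde X$ does not have causal curvature bounded above (by any $K\in\mathbb R$).
   Context: **Lorentzian pre-length spaces.** A causal space is a set $X$ with a preorder $\leq$ and a transitive relation $\ll$ contained in $\leq$. Write $x<y$ if $x\leq y$ and $x\neq y$. Put $I^+(x)=\{y: x\ll y\}$, $I^-(x)=\{y:y\ll x\}$. If $X$ also carries a metric $d$ and a lower semicontinuous map $\tau\colon X\times X\to[0,\infty]$ with $\tau(x,z)\geq\tau(x,y)+\tau(y,z)$ for all $x\le y\le z$, $\tau(x,y)=0$ if $x\nleq y$, and $\tau(x,y)>0\Leftrightarrow x\ll y$, then $(X,d,\ll,\leq,\tau)$ is a Lorentzian pre-length space. **Curves and length.** A non-constant curve $\gamma\colon I\to X$ ($I$ an interval) is future-directed causal (timelike) if it is locally Lipschitz continuous with respect to $d$ and $\gamma(t_1)\leq\gamma(t_2)$ ($\gamma(t_1)\ll\gamma(t_2)$) for all $t_1<t_2$ in $I$; past-directed curves are defined with the relations reversed. For $\gamma\colon[a,b]\to X$ future-directed causal, $L_\tau(\gamma):=\inf\{\sum_{i=0}^{N-1}\tau(\gamma(t_i),\gamma(t_{i+1})) : a=t_0<t_1<\dots<t_N=b,\ N\in\mathbb N\}$; if the interval is $[a,b)$ one uses partitions with $a=t_0<\dots<t_N<b$,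 and similarly in the other cases. A future-directed causal $\gamma\colon[a,b]\to X$ is maximal if $L_\tau(\gamma)=\tau(\gamma(a),\gamma(b))$. **Localisability.** $X$ is localisable (localising) if every $x\in X$ has an open, so-called localising, neighbourhood $\Omega_x$ such that: (i) the $d$-length of all causal curves contained in $\Omega_x$ is uniformly bounded; (ii) there is a continuous map $\omega_x\colon\Omega_x\times\Omega_x\to[0,\infty)$ (the local time separation function) such that $\Omega_x$ with the restrictions of $d,\ll,\leq$ and with $\omega_x$ is a Lorentzian pre-length space, and $I^\pm(y)\cap\Omega_x\neq\emptyset$ for every $y\in\Omega_x$; (iii) for all $p,q\in\Omega_x$ with $p<q$ there is a future-directed causal curve $\gamma_{p,q}$ from $p$ to $q$ that is maximal in $\Omega_x$ (has maximal $L_\tau$ among future-directed causal curves in $\Omega_x$ from $p$ to $q$) and satisfies $L_\tau(\gamma_{p,q})=\omega_x(p,q)\leq\tau(p,q)$. **Lorentzian length spaces.** $X$ is causally path connected if for $x\ll y$ (resp. $x<y$) there is a future-directed timelike (resp. causal) curve from $x$ to $y$. $X$ is locally causally closed if every point has a neighbourhood $U$ such that $\leq$ is closed in $\bar U\times\bar U$. Let $\mathcal T(x,y):=\sup\{L_\tau(\gamma):\gamma\text{ future-directed causal from }x\text{ to }y\}$ if such curves exist, and $\mathcal T(x,y):=0$ otherwise. A Lorentzian length space is a locally causally closed, causally path connected, localisable Lorentzian pre-length space with $\tau=\mathcal T$. It is strongly causal if the topology with subbase $\{I^+(x)\cap I^-(y):x,y\in X\}$ equals the topology induced by $d$. It is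 locally timelike geodesically connected if every point has a neighbourhood $U$ such that whenever $x,y\in U$ with $x\ll y$ there is a future-directed maximal timelike curve in $U$ from $x$ to $y$. **Geodesics and $(TC)$.** In a localising Lorentzian pre-length space a future-directed causal curve $\gamma\colon I\to X$ is a geodesic if for every $t_0\in I$ there are a localising neighbourhood $\Omega$ of $\gamma(t_0)$ (with local time separation function $\omega$) and a neighbourhood $J=[c,d]$ of $t_0$ in $I$ such that $\gamma|_J$ is maximal in $\Omega$ from $\gamma(c)$ to $\gamma(d)$, i.e. $L_\tau(\gamma|_{[c,d]})=\omega(\gamma(c),\gamma(d))$. A timelike geodesic is a geodesic that is a timelike curve. A future-directed geodesic $\gamma\colon[a,b)\to X$ is extendible as a geodesic if there is a future-directed geodesic $\bar\gamma\colon[a,b]\to X$ with $\bar\gamma|_{[a,b)}=\gamma$; otherwise it is inextendible as a geodesic (analogously towards the past). $X$ has property $(TC)$ if all inextendible timelike geodesics have infinite $\tau$-length. **Extensions.** A Lorentzian pre-length space $(\tilde X,\tilde d,\tilde\ll,\tilde\leq,\tilde\tau)$ is an extension of $(X,d,\ll,\leq,\tau)$ if: (i) $(\tilde X,\tilde d)$ is connected; (ii) there is an isometry $\iota\colon(X,d)\to(\tilde X,\tilde d)$ of metric spaces (not required to be onto); (iii) $\iota(X)$ is a proper, open subset of $\tilde X$; (iv) $x\leq y\Rightarrow\iota(x)\,\tilde\leq\,\iota(y)$ and $x\ll y\Rightarrow\iota(x)\,\tilde\ll\,\iota(y)$; (v) a curve $\gamma\colon I\to X$ is timelike (resp. causal)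 if and only if $\iota\circ\gamma$ is timelike (resp. causal) in $\tilde X$, and $L_\tau(\gamma)=L_{\tilde\tau}(\iota\circ\gamma)$ for every causal curve $\gamma\colon I\to X$. **Causal curvature bounds.** An admissible causal geodesic triangle is a triple $(x,y,z)\in X^3$ with $x\ll y\leq z$ or $x\leq y\ll z$ such that $\tau(x,z)<\infty$ and the sides (if non-trivial) are realized by future-directed causal curves. For $K\in\mathbb R$ the model space $M_K$ is: the simply connected covering of two-dimensional de Sitter space $S^2_1(r)$ if $K=1/r^2$; two-dimensional Minkowski space $\mathbb R^2_1$ if $K=0$; the simply connected covering of two-dimensional anti-de Sitter space $H^2_1(r)$ if $K=-1/r^2$; $\bar\tau$ denotes its time separation function. A triple $(a,b,c)\in\mathbb R_+^3$ with $c\geq a+b$ satisfies timelike size bounds for $K$ if: when $c=a+b$, $c<\pi/\sqrt K$ (with $\pi/\sqrt K:=\infty$ if $K\leq0$); otherwise, if $K<0$, $c<\pi/\sqrt{-K}$. A comparison triangle is a triangle in $M_K$ with the same side lengths; corresponding points divide corresponding timelike sides at equal time separations from the endpoints. $X$ has causal curvature bounded above by $K$ if every point has a neighbourhood $U$ such that: (i) $\tau|_{U\times U}$ is finite and continuous; (ii) for $x,y\in U$ with $x<y$ there is a causal curve $\alpha$ in $U$ (from $x$ to $y$) with $L_\tau(\alpha)=\tau(x,y)$; (iii) if $(x,y,z)$ is an admissible causal geodesic triangle in $U$, realized by maximal causal curves (or a constant curve, respectively), whose side lengths satisfy timelike size bounds for $K$, and $(\bar x,\bar y,\bar z)$ is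 a comparison triangle in $M_K$ realized by causal geodesics (or a constant curve), then for all points $p,q$ on the timelike sides of $(x,y,z)$ and corresponding points $\bar p,\bar q$ on the timelike sides of $(\bar x,\bar y,\bar z)$ one has $\tau(p,q)\geq\bar\tau(\bar p,\bar q)$. $X$ has causal curvature bounded above if this holds for some $K\in\mathbb R$. "Causal curvature singularity" is here understood in the sense made specific in the statement: causal curvature is not bounded above. *)

theory Defs
  imports "HOL-Analysis.Analysis"
begin

section \<open>Lorentzian pre-length spaces\<close>

text \<open>
  The underlying set of a space is the carrier \<open>mspace (metr X)\<close>; the relations and the time
  separation function are relevant on this carrier only.
\<close>

record 'a lspace =
  metr :: "'a metric"
  chron :: "'a \<Rightarrow> 'a \<Rightarrow> bool"
  caus :: "'a \<Rightarrow> 'a \<Rightarrow> bool"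
  tsep :: "'a \<Rightarrow> 'a \<Rightarrow> ennreal"

definition pts :: "'a lspace \<Rightarrow> 'a set" where
  "pts X = mspace (metr X)"

definition ltop :: "'a lspace \<Rightarrow> 'a topology" where
  "ltop X = mtopology_of (metr X)"

definition chron_future :: "'a lspace \<Rightarrow> 'a \<Rightarrow> 'a set" where
  "chron_future X x = {y \<in> pts X. chron X x y}"

definition chron_past :: "'a lspace \<Rightarrow> 'a \<Rightarrow> 'a set" where
  "chron_past X x = {y \<in> pts X. chron X y x}"

definition neighbourhood :: "'a lspace \<Rightarrow> 'a \<Rightarrow> 'a set \<Rightarrow> bool" where
  "neighbourhood X x U \<longleftrightarrow> U \<subseteq> pts X \<and> (\<exists>V. openin (ltop X) V \<and> x \<in> V \<and> V \<subseteq> U)"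

definition causal_space :: "'a lspace \<Rightarrow> bool" where
  "causal_space X \<longleftrightarrow>
     reflp_on (pts X) (caus X) \<and> transp_on (pts X) (caus X) \<and> transp_on (pts X) (chron X) \<and>
     (\<forall>x\<in>pts X. \<forall>y\<in>pts X. chron X x y \<longrightarrow> caus X x y)"

text \<open>Spaces are non-empty by convention.\<close>

definition lorentzian_pre_length_space :: "'a lspace \<Rightarrow> bool" where
  "lorentzian_pre_length_space X \<longleftrightarrow>
     pts X \<noteq> {} \<and> causal_space X \<and>
     (\<forall>c. openin (prod_topology (ltop X) (ltop X))
            {(x, y). x \<in> pts X \<and> y \<in> pts X \<and> c < tsep X x y}) \<and>
     (\<forall>x\<in>pts X. \<forall>y\<in>pts X. \<forall>z\<in>pts X. caus X x y \<and> caus X y z \<longrightarrow>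
        tsep X x y + tsep X y z \<le> tsep X x z) \<and>
     (\<forall>x\<in>pts X. \<forall>y\<in>pts X. \<not> caus X x y \<longrightarrow> tsep X x y = 0) \<and>
     (\<forall>x\<in>pts X. \<forall>y\<in>pts X. 0 < tsep X x y \<longleftrightarrow> chron X x y)"


section \<open>Curves and length\<close>

definition locally_Lipschitz_curve :: "'a lspace \<Rightarrow> (real \<Rightarrow> 'a) \<Rightarrow> real set \<Rightarrow> bool" where
  "locally_Lipschitz_curve X \<gamma> I \<longleftrightarrow>
     (\<forall>t\<in>I. \<exists>e>0. Lipschitz_continuous_map (submetric euclidean_metric (I \<inter> ball t e)) (metr X) \<gamma>)"

definition curve_along ::
  "'a lspace \<Rightarrow> ('a \<Rightarrow> 'a \<Rightarrow> bool) \<Rightarrow> (real \<Rightarrow> 'a) \<Rightarrow> real set \<Rightarrow> bool" where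
  "curve_along X R \<gamma> I \<longleftrightarrow>
     is_interval I \<and> \<gamma> ` I \<subseteq> pts X \<and> (\<exists>s\<in>I. \<exists>t\<in>I. \<gamma> s \<noteq> \<gamma> t) \<and>
     locally_Lipschitz_curve X \<gamma> I \<and> (\<forall>s\<in>I. \<forall>t\<in>I. s < t \<longrightarrow> R (\<gamma> s) (\<gamma> t))"

definition fd_causal :: "'a lspace \<Rightarrow> (real \<Rightarrow> 'a) \<Rightarrow> real set \<Rightarrow> bool" where
  "fd_causal X \<gamma> I \<longleftrightarrow> curve_along X (caus X) \<gamma> I"

definition fd_timelike :: "'a lspace \<Rightarrow> (real \<Rightarrow> 'a) \<Rightarrow> real set \<Rightarrow> bool" where
  "fd_timelike X \<gamma> I \<longleftrightarrow> curve_along X (chron X) \<gamma> I"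

definition causal_curve :: "'a lspace \<Rightarrow> (real \<Rightarrow> 'a) \<Rightarrow> real set \<Rightarrow> bool" where
  "causal_curve X \<gamma> I \<longleftrightarrow> fd_causal X \<gamma> I \<or> curve_along X (\<lambda>p q. caus X q p) \<gamma> I"

definition timelike_curve :: "'a lspace \<Rightarrow> (real \<Rightarrow> 'a) \<Rightarrow> real set \<Rightarrow> bool" where
  "timelike_curve X \<gamma> I \<longleftrightarrow> fd_timelike X \<gamma> I \<or> curve_along X (\<lambda>p q. chron X q p) \<gamma> I"

definition fd_causal_from_to ::
  "'a lspace \<Rightarrow> (real \<Rightarrow> 'a) \<Rightarrow> real \<Rightarrow> real \<Rightarrow> 'a \<Rightarrow> 'a \<Rightarrow> bool" where
  "fd_causal_from_to X \<gamma> a b p q \<longleftrightarrow> fd_causal X \<gamma> {a..b} \<and> \<gamma> a = p \<and> \<gamma> b = q"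

definition fd_timelike_from_to ::
  "'a lspace \<Rightarrow> (real \<Rightarrow> 'a) \<Rightarrow> real \<Rightarrow> real \<Rightarrow> 'a \<Rightarrow> 'a \<Rightarrow> bool" where
  "fd_timelike_from_to X \<gamma> a b p q \<longleftrightarrow> fd_timelike X \<gamma> {a..b} \<and> \<gamma> a = p \<and> \<gamma> b = q"

definition partition_of :: "real \<Rightarrow> real \<Rightarrow> nat \<Rightarrow> (nat \<Rightarrow> real) \<Rightarrow> bool" where
  "partition_of a b N t \<longleftrightarrow> t 0 = a \<and> t N = b \<and> (\<forall>i<N. t i < t (Suc i))"

text \<open>\<open>tau_length_seg X \<gamma> a b\<close> is the \<open>\<tau>\<close>-length of the restriction of \<open>\<gamma>\<close> to \<open>[a, b]\<close>.\<close>

definition tau_length_seg :: "'a lspace \<Rightarrow> (real \<Rightarrow> 'a) \<Rightarrow> real \<Rightarrow> real \<Rightarrow> ennreal" where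
  "tau_length_seg X \<gamma> a b =
     Inf {(\<Sum>i<N. tsep X (\<gamma> (t i)) (\<gamma> (t (Suc i)))) | N t. partition_of a b N t}"

text \<open>
  On an interval that is not compact the partitions \<open>a = t 0 < ... < t N < b\<close> do not reach the
  missing end point.  A plain infimum over all of them would be governed by the short partitions
  near \<open>a\<close>; what is meant is the infimum over the partitions of \<open>[a, t N]\<close>, in the limit of
  \<open>t N\<close> tending to \<open>b\<close>.  By the reverse triangle inequality this limit is a supremum.  For the
  same reason the supremum over compact subintervals agrees with \<open>tau_length_seg\<close> on a compact
  interval.
\<close>

definition tau_length :: "'a lspace \<Rightarrow> (real \<Rightarrow> 'a) \<Rightarrow> real set \<Rightarrow> ennreal" where
  "tau_length X \<gamma> I = Sup {tau_length_seg X \<gamma> c d | c d. c \<in> I \<and> d \<in> I \<and> c < d}"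

definition d_length :: "'a lspace \<Rightarrow> (real \<Rightarrow> 'a) \<Rightarrow> real set \<Rightarrow> ennreal" where
  "d_length X \<gamma> I =
     Sup {(\<Sum>i<N. ennreal (mdist (metr X) (\<gamma> (t i)) (\<gamma> (t (Suc i))))) | N t c d.
            c \<in> I \<and> d \<in> I \<and> partition_of c d N t}"

definition maximal_curve :: "'a lspace \<Rightarrow> (real \<Rightarrow> 'a) \<Rightarrow> real \<Rightarrow> real \<Rightarrow> bool" where
  "maximal_curve X \<gamma> a b \<longleftrightarrow>
     fd_causal X \<gamma> {a..b} \<and> tau_length_seg X \<gamma> a b = tsep X (\<gamma> a) (\<gamma> b)"


section \<open>Localisability\<close>

definition local_lspace :: "'a lspace \<Rightarrow> 'a set \<Rightarrow> ('a \<Rightarrow> 'a \<Rightarrow> real) \<Rightarrow> 'a lspace" where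
  "local_lspace X \<Omega> \<omega> =
     \<lparr>metr = submetric (metr X) \<Omega>, chron = chron X, caus = caus X,
      tsep = (\<lambda>p q. ennreal (\<omega> p q))\<rparr>"

definition localising_nbhd ::
  "'a lspace \<Rightarrow> 'a \<Rightarrow> 'a set \<Rightarrow> ('a \<Rightarrow> 'a \<Rightarrow> real) \<Rightarrow> bool" where
  "localising_nbhd X x \<Omega> \<omega> \<longleftrightarrow>
     openin (ltop X) \<Omega> \<and> x \<in> \<Omega> \<and>
     (\<exists>C::real. \<forall>\<gamma> I. causal_curve X \<gamma> I \<and> \<gamma> ` I \<subseteq> \<Omega> \<longrightarrow> d_length X \<gamma> I \<le> ennreal C) \<and>
     (\<forall>p\<in>\<Omega>. \<forall>q\<in>\<Omega>. 0 \<le> \<omega> p q) \<and>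
     continuous_map (prod_topology (subtopology (ltop X) \<Omega>) (subtopology (ltop X) \<Omega>))
       euclideanreal (\<lambda>(p, q). \<omega> p q) \<and>
     lorentzian_pre_length_space (local_lspace X \<Omega> \<omega>) \<and>
     (\<forall>y\<in>\<Omega>. chron_future X y \<inter> \<Omega> \<noteq> {} \<and> chron_past X y \<inter> \<Omega> \<noteq> {}) \<and>
     (\<forall>p\<in>\<Omega>. \<forall>q\<in>\<Omega>. caus X p q \<and> p \<noteq> q \<longrightarrow>
        (\<exists>\<gamma> a b. fd_causal_from_to X \<gamma> a b p q \<and> \<gamma> ` {a..b} \<subseteq> \<Omega> \<and>
           (\<forall>\<sigma> a' b'. fd_causal_from_to X \<sigma> a' b' p q \<and> \<sigma> ` {a'..b'} \<subseteq> \<Omega> \<longrightarrow>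
              tau_length_seg X \<sigma> a' b' \<le> tau_length_seg X \<gamma> a b) \<and>
           tau_length_seg X \<gamma> a b = ennreal (\<omega> p q) \<and> ennreal (\<omega> p q) \<le> tsep X p q))"

definition localisable :: "'a lspace \<Rightarrow> bool" where
  "localisable X \<longleftrightarrow> (\<forall>x\<in>pts X. \<exists>\<Omega> \<omega>. localising_nbhd X x \<Omega> \<omega>)"


section \<open>Lorentzian length spaces\<close>

definition causally_path_connected :: "'a lspace \<Rightarrow> bool" where
  "causally_path_connected X \<longleftrightarrow>
     (\<forall>x\<in>pts X. \<forall>y\<in>pts X.
        (chron X x y \<longrightarrow> (\<exists>\<gamma> a b. fd_timelike_from_to X \<gamma> a b x y)) \<and>
        (caus X x y \<and> x \<noteq> y \<longrightarrow> (\<exists>\<gamma> a b. fd_causal_from_to X \<gamma> a b x y)))"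

definition locally_causally_closed :: "'a lspace \<Rightarrow> bool" where
  "locally_causally_closed X \<longleftrightarrow>
     (\<forall>x\<in>pts X. \<exists>U. neighbourhood X x U \<and>
        (let V = ltop X closure_of U in
          closedin (prod_topology (subtopology (ltop X) V) (subtopology (ltop X) V))
            {(p, q). p \<in> V \<and> q \<in> V \<and> caus X p q}))"

text \<open>The supremum of the empty set of lengths is \<open>0\<close> in \<^typ>\<open>ennreal\<close>.\<close>

definition length_tsep :: "'a lspace \<Rightarrow> 'a \<Rightarrow> 'a \<Rightarrow> ennreal" where
  "length_tsep X x y = Sup {tau_length_seg X \<gamma> a b | \<gamma> a b. fd_causal_from_to X \<gamma> a b x y}"

definition lorentzian_length_space :: "'a lspace \<Rightarrow> bool" where
  "lorentzian_length_space X \<longleftrightarrow>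
     lorentzian_pre_length_space X \<and> locally_causally_closed X \<and> causally_path_connected X \<and>
     localisable X \<and> (\<forall>x\<in>pts X. \<forall>y\<in>pts X. tsep X x y = length_tsep X x y)"

text \<open>
  \<^const>\<open>topology_generated_by\<close> does not adjoin the empty intersection, so the whole space is
  added to the subbase.
\<close>

definition strongly_causal :: "'a lspace \<Rightarrow> bool" where
  "strongly_causal X \<longleftrightarrow>
     topology_generated_by
       (insert (pts X) {chron_future X x \<inter> chron_past X y | x y. x \<in> pts X \<and> y \<in> pts X}) = ltop X"

definition locally_timelike_geodesically_connected :: "'a lspace \<Rightarrow> bool" where
  "locally_timelike_geodesically_connected X \<longleftrightarrow>
     (\<forall>p\<in>pts X. \<exists>U. neighbourhood X p U \<and>
        (\<forall>x\<in>U. \<forall>y\<in>U. chron X x y \<longrightarrow>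
           (\<exists>\<gamma> a b. fd_timelike_from_to X \<gamma> a b x y \<and> maximal_curve X \<gamma> a b \<and> \<gamma> ` {a..b} \<subseteq> U)))"


section \<open>Geodesics and property (TC)\<close>

definition geodesic :: "'a lspace \<Rightarrow> (real \<Rightarrow> 'a) \<Rightarrow> real set \<Rightarrow> bool" where
  "geodesic X \<gamma> I \<longleftrightarrow>
     fd_causal X \<gamma> I \<and>
     (\<forall>t\<in>I. \<exists>\<Omega> \<omega> c d e. localising_nbhd X (\<gamma> t) \<Omega> \<omega> \<and>
        c < d \<and> t \<in> {c..d} \<and> {c..d} \<subseteq> I \<and> 0 < e \<and> I \<inter> ball t e \<subseteq> {c..d} \<and>
        \<gamma> ` {c..d} \<subseteq> \<Omega> \<and> tau_length_seg X \<gamma> c d = ennreal (\<omega> (\<gamma> c) (\<gamma> d)))"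

definition timelike_geodesic :: "'a lspace \<Rightarrow> (real \<Rightarrow> 'a) \<Rightarrow> real set \<Rightarrow> bool" where
  "timelike_geodesic X \<gamma> I \<longleftrightarrow> geodesic X \<gamma> I \<and> fd_timelike X \<gamma> I"

definition future_extendible :: "'a lspace \<Rightarrow> (real \<Rightarrow> 'a) \<Rightarrow> real \<Rightarrow> real \<Rightarrow> bool" where
  "future_extendible X \<gamma> a b \<longleftrightarrow>
     (\<exists>\<gamma>'. geodesic X \<gamma>' {a..b} \<and> (\<forall>t\<in>{a..<b}. \<gamma>' t = \<gamma> t))"

definition past_extendible :: "'a lspace \<Rightarrow> (real \<Rightarrow> 'a) \<Rightarrow> real \<Rightarrow> real \<Rightarrow> bool" where
  "past_extendible X \<gamma> a b \<longleftrightarrow>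
     (\<exists>\<gamma>'. geodesic X \<gamma>' {a..b} \<and> (\<forall>t\<in>{a<..b}. \<gamma>' t = \<gamma> t))"

text \<open>
  Extendibility is a property of curves up to reparametrisation.  For a fixed parametrisation an
  extension may fail to exist merely because the curve is not Lipschitz at its end point, as for
  \<open>t \<mapsto> (- sqrt (1 - t), 0)\<close> on \<open>[0, 1)\<close> in the Minkowski plane, and then no space containing a
  timelike geodesic would satisfy (TC).  An inextendible geodesic is therefore one none of
  whose reparametrisations is extendible.
\<close>

definition reparam :: "real set \<Rightarrow> (real \<Rightarrow> real) \<Rightarrow> bool" where
  "reparam I \<phi> \<longleftrightarrow> strict_mono_on I \<phi> \<and> \<phi> ` I = I"

definition property_TC :: "'a lspace \<Rightarrow> bool" where
  "property_TC X \<longleftrightarrow>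
     (\<forall>\<gamma> a b. timelike_geodesic X \<gamma> {a..<b} \<and>
        (\<forall>\<phi>. reparam {a..<b} \<phi> \<longrightarrow> \<not> future_extendible X (\<gamma> \<circ> \<phi>) a b) \<longrightarrow>
        tau_length X \<gamma> {a..<b} = \<infinity>) \<and>
     (\<forall>\<gamma> a b. timelike_geodesic X \<gamma> {a<..b} \<and>
        (\<forall>\<phi>. reparam {a<..b} \<phi> \<longrightarrow> \<not> past_extendible X (\<gamma> \<circ> \<phi>) a b) \<longrightarrow>
        tau_length X \<gamma> {a<..b} = \<infinity>)"


section \<open>Extensions\<close>

definition extension_via :: "('a \<Rightarrow> 'b) \<Rightarrow> 'a lspace \<Rightarrow> 'b lspace \<Rightarrow> bool" where
  "extension_via \<iota> X Y \<longleftrightarrow>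
     connected_space (ltop Y) \<and>
     \<iota> ` pts X \<subseteq> pts Y \<and>
     (\<forall>x\<in>pts X. \<forall>y\<in>pts X. mdist (metr Y) (\<iota> x) (\<iota> y) = mdist (metr X) x y) \<and>
     \<iota> ` pts X \<noteq> pts Y \<and> openin (ltop Y) (\<iota> ` pts X) \<and>
     (\<forall>x\<in>pts X. \<forall>y\<in>pts X. (caus X x y \<longrightarrow> caus Y (\<iota> x) (\<iota> y)) \<and>
        (chron X x y \<longrightarrow> chron Y (\<iota> x) (\<iota> y))) \<and>
     (\<forall>\<gamma> I. is_interval I \<and> \<gamma> ` I \<subseteq> pts X \<longrightarrow>
        (timelike_curve X \<gamma> I \<longleftrightarrow> timelike_curve Y (\<iota> \<circ> \<gamma>) I) \<and>
        (causal_curve X \<gamma> I \<longleftrightarrow> causal_curve Y (\<iota> \<circ> \<gamma>) I)) \<and>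
     (\<forall>\<gamma> I. fd_causal X \<gamma> I \<longrightarrow> tau_length X \<gamma> I = tau_length Y (\<iota> \<circ> \<gamma>) I)"

definition is_extension :: "'a lspace \<Rightarrow> 'b lspace \<Rightarrow> bool" where
  "is_extension X Y \<longleftrightarrow>
     lorentzian_pre_length_space X \<and> lorentzian_pre_length_space Y \<and> (\<exists>\<iota>. extension_via \<iota> X Y)"


section \<open>Model spaces\<close>

text \<open>
  The de Sitter and anti-de Sitter planes are the quadrics \<open>model_form K v = 1 / K\<close> in
  three-dimensional space, with the metric induced by \<open>model_form K\<close>.  Their simply connected
  coverings are diffeomorphic to the plane; \<open>model_map K\<close> is the covering map in global
  coordinates \<open>(t, x)\<close>, in which the future is the direction of increasing \<open>t\<close>.  The induced
  metrics are
  \<open>r\<^sup>2 (- dt\<^sup>2 + cosh\<^sup>2 t dx\<^sup>2)\<close> for \<open>K = 1 / r\<^sup>2\<close>, \<open>- dt\<^sup>2 + dx\<^sup>2\<close> for \<open>K = 0\<close> and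
  \<open>r\<^sup>2 (- cosh\<^sup>2 x dt\<^sup>2 + dx\<^sup>2)\<close> for \<open>K = - 1 / r\<^sup>2\<close>.
\<close>

type_synonym model_point = "real \<times> real"

definition model_form :: "real \<Rightarrow> real \<times> real \<times> real \<Rightarrow> real" where
  "model_form K = (\<lambda>(u, v, w). if K < 0 then - u\<^sup>2 - v\<^sup>2 + w\<^sup>2 else - u\<^sup>2 + v\<^sup>2 + w\<^sup>2)"

definition model_map :: "real \<Rightarrow> model_point \<Rightarrow> real \<times> real \<times> real" where
  "model_map K = (\<lambda>(t, x).
     if K > 0 then (1 / sqrt K) *\<^sub>R (sinh t, cosh t * cos x, cosh t * sin x)
     else if K < 0 then (1 / sqrt (- K)) *\<^sub>R (cosh x * cos t, cosh x * sin t, sinh x)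
     else (t, x, 0))"

definition model_velocity :: "real \<Rightarrow> (real \<Rightarrow> model_point) \<Rightarrow> real \<Rightarrow> real \<times> real \<times> real" where
  "model_velocity K c s = vector_derivative (model_map K \<circ> c) (at s)"

definition model_causal :: "real \<Rightarrow> (real \<Rightarrow> model_point) \<Rightarrow> real \<Rightarrow> real \<Rightarrow> bool" where
  "model_causal K c a b \<longleftrightarrow>
     a < b \<and> continuous_on {a..b} c \<and>
     (\<exists>S. finite S \<and> c C1_differentiable_on ({a..b} - S) \<and>
        (\<forall>s\<in>{a..b} - S. 0 < vector_derivative (fst \<circ> c) (at s) \<and>
           model_form K (model_velocity K c s) \<le> 0))"

definition model_length :: "real \<Rightarrow> (real \<Rightarrow> model_point) \<Rightarrow> real \<Rightarrow> real \<Rightarrow> ennreal" where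
  "model_length K c a b =
     (\<integral>\<^sup>+ s\<in>{a..b}. ennreal (sqrt (- model_form K (model_velocity K c s))) \<partial>lborel)"

definition model_tau :: "real \<Rightarrow> model_point \<Rightarrow> model_point \<Rightarrow> ennreal" where
  "model_tau K p q =
     Sup {model_length K c a b | c a b. model_causal K c a b \<and> c a = p \<and> c b = q}"

text \<open>
  A curve in the quadric is an affinely parametrised geodesic if and only if its acceleration in
  the surrounding space is normal to the quadric, that is, a multiple of the position vector.
\<close>

definition model_geodesic :: "real \<Rightarrow> (real \<Rightarrow> model_point) \<Rightarrow> real \<Rightarrow> real \<Rightarrow> bool" where
  "model_geodesic K c a b \<longleftrightarrow>
     model_causal K c a b \<and>
     (\<exists>w. \<forall>s\<in>{a..b}.
        ((model_map K \<circ> c) has_vector_derivative w s) (at s within {a..b}) \<and>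
        (\<exists>l. (K = 0 \<longrightarrow> l = 0) \<and>
           (w has_vector_derivative l *\<^sub>R model_map K (c s)) (at s within {a..b})))"


section \<open>Causal curvature bounds\<close>

definition timelike_size_bounds :: "real \<Rightarrow> real \<Rightarrow> real \<Rightarrow> real \<Rightarrow> bool" where
  "timelike_size_bounds K a b c \<longleftrightarrow>
     0 \<le> a \<and> 0 \<le> b \<and> 0 \<le> c \<and> a + b \<le> c \<and>
     (if c = a + b then K > 0 \<longrightarrow> c < pi / sqrt K else K < 0 \<longrightarrow> c < pi / sqrt (- K))"

text \<open>
  Sides are represented by the image of a curve realising them; a side with equal end points is
  constant.  In the model space a side may be constant even if the side it is compared with is a
  non-trivial null curve.
\<close>

definition maximal_side :: "'a lspace \<Rightarrow> 'a set \<Rightarrow> 'a \<Rightarrow> 'a \<Rightarrow> 'a set \<Rightarrow> bool" where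
  "maximal_side X U p q S \<longleftrightarrow>
     (if p = q then S = {p}
      else \<exists>\<gamma> a b. fd_causal_from_to X \<gamma> a b p q \<and> maximal_curve X \<gamma> a b \<and>
             S = \<gamma> ` {a..b} \<and> S \<subseteq> U)"

definition model_side :: "real \<Rightarrow> model_point \<Rightarrow> model_point \<Rightarrow> model_point set \<Rightarrow> bool" where
  "model_side K p q S \<longleftrightarrow>
     (if p = q then S = {p}
      else \<exists>c a b. model_geodesic K c a b \<and> c a = p \<and> c b = q \<and>
             model_length K c a b = model_tau K p q \<and> S = c ` {a..b})"

definition corresponding_points ::
  "'a lspace \<Rightarrow> real \<Rightarrow> 'a \<Rightarrow> 'a \<Rightarrow> 'a set \<Rightarrow> model_point \<Rightarrow> model_point \<Rightarrow> model_point set \<Rightarrow>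
   ('a \<times> model_point) set" where
  "corresponding_points X K u v S u' v' S' =
     {(p, p'). chron X u v \<and> p \<in> S \<and> p' \<in> S' \<and>
        tsep X u p = model_tau K u' p' \<and> tsep X p v = model_tau K p' v'}"

definition triangle_comparison_above :: "'a lspace \<Rightarrow> 'a set \<Rightarrow> real \<Rightarrow> bool" where
  "triangle_comparison_above X U K \<longleftrightarrow>
     (\<forall>x\<in>U. \<forall>y\<in>U. \<forall>z\<in>U. \<forall>S1 S2 S3 x' y' z' S1' S2' S3'.
        ((chron X x y \<and> caus X y z) \<or> (caus X x y \<and> chron X y z)) \<and>
        tsep X x z < \<infinity> \<and>
        maximal_side X U x y S1 \<and> maximal_side X U y z S2 \<and> maximal_side X U x z S3 \<and>
        timelike_size_bounds K
          (enn2real (tsep X x y)) (enn2real (tsep X y z)) (enn2real (tsep X x z)) \<and>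
        model_tau K x' y' = tsep X x y \<and> model_tau K y' z' = tsep X y z \<and>
        model_tau K x' z' = tsep X x z \<and>
        model_side K x' y' S1' \<and> model_side K y' z' S2' \<and> model_side K x' z' S3' \<longrightarrow>
        (let C = corresponding_points X K x y S1 x' y' S1' \<union>
                 corresponding_points X K y z S2 y' z' S2' \<union>
                 corresponding_points X K x z S3 x' z' S3'
         in \<forall>(p, p')\<in>C. \<forall>(q, q')\<in>C. tsep X p q \<ge> model_tau K p' q'))"

definition causal_curvature_bounded_above_by :: "'a lspace \<Rightarrow> real \<Rightarrow> bool" where
  "causal_curvature_bounded_above_by X K \<longleftrightarrow>
     (\<forall>x\<in>pts X. \<exists>U. neighbourhood X x U \<and>
        (\<forall>p\<in>U. \<forall>q\<in>U. tsep X p q < \<infinity>) \<and>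
        continuous_map (prod_topology (subtopology (ltop X) U) (subtopology (ltop X) U)) euclidean
          (\<lambda>(p, q). tsep X p q) \<and>
        (\<forall>p\<in>U. \<forall>q\<in>U. caus X p q \<and> p \<noteq> q \<longrightarrow>
           (\<exists>\<alpha> a b. fd_causal_from_to X \<alpha> a b p q \<and> \<alpha> ` {a..b} \<subseteq> U \<and>
              tau_length_seg X \<alpha> a b = tsep X p q)) \<and>
        triangle_comparison_above X U K)"

definition causal_curvature_bounded_above :: "'a lspace \<Rightarrow> bool" where
  "causal_curvature_bounded_above X \<longleftrightarrow> (\<exists>K. causal_curvature_bounded_above_by X K)"

end

theory Submission
  imports Defs
begin

text \<open>
  The idea is that a maximal timelike curve of the extension which crosses the boundary of the
  original space \<open>X\<close> is, up to the crossing, a timelike geodesic of \<open>X\<close> which contradicts (TC).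

  Such a curve exists near every boundary point \<open>p\<close> of \<open>\<iota>(X)\<close>.  Choose \<open>q\<close> in the timelike future
  of \<open>p\<close>, and \<open>x \<in> \<iota>(X)\<close> so close to \<open>p\<close> that still \<open>x\<close> precedes \<open>q\<close>.  If \<open>q\<close> is outside \<open>\<iota>(X)\<close>,
  a maximal timelike curve from \<open>x\<close> to \<open>q\<close> leaves \<open>\<iota>(X)\<close>; if \<open>q\<close> is inside, one from \<open>p\<close> to \<open>q\<close>
  enters it (lemma \<open>maximal_curve_meeting_both\<close>).  As \<open>\<iota>(X)\<close> is open, there is a first exit or a
  last entry parameter.

  Let \<open>\<sigma>\<close> be the part of the curve inside \<open>\<iota>(X)\<close>, read as a curve of \<open>X\<close>.  It is a geodesic of
  \<open>X\<close>: in a localising neighbourhood of \<open>X\<close>, any competitor has as its length the length of its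
  image in the extension, which is at most the time separation there, which is the length of the
  maximal curve (lemma \<open>pullback_length_eq_local_tsep\<close>).  The bound on causal
  curvature contributes that the time separation of the extension is finite near \<open>p\<close>; hence \<open>\<sigma>\<close>
  has finite length.  By (TC), \<open>\<sigma>\<close> has a limit in \<open>X\<close>; this limit is mapped to the
  crossing point, which is not in \<open>\<iota>(X)\<close> (lemma \<open>endpoint_in_image\<close>).
\<close>

section \<open>Partition sums and the length of causal curves\<close>

text \<open>
  Generating partitions point by point from the left makes it possible to cut and to join them by
  rule induction, without reindexing.
\<close>

inductive partition_sum :: "'a lspace \<Rightarrow> (real \<Rightarrow> 'a) \<Rightarrow> real \<Rightarrow> real \<Rightarrow> ennreal \<Rightarrow> bool"
  for X \<gamma> where
  single: "a < b \<Longrightarrow> partition_sum X \<gamma> a b (tsep X (\<gamma> a) (\<gamma> b))"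
| step: "a < b \<Longrightarrow> partition_sum X \<gamma> b c s \<Longrightarrow> partition_sum X \<gamma> a c (tsep X (\<gamma> a) (\<gamma> b) + s)"

lemma partition_sum_less: "partition_sum X \<gamma> a b s \<Longrightarrow> a < b"
  by (induction rule: partition_sum.induct) auto

lemma partition_sum_of_partition:
  assumes "partition_of a b (Suc N) t"
  shows "partition_sum X \<gamma> a b (\<Sum>i<Suc N. tsep X (\<gamma> (t i)) (\<gamma> (t (Suc i))))"
  using assms
proof (induction N arbitrary: a t)
  case 0
  then show ?case by (auto simp: partition_of_def intro: partition_sum.single)
next
  case (Suc N)
  have "partition_of (t 1) b (Suc N) (\<lambda>i. t (Suc i))"
    using Suc.prems by (auto simp: partition_of_def)
  from Suc.IH[OF this] Suc.prems
  have "partition_sum X \<gamma> (t 0) b (tsep X (\<gamma> (t 0)) (\<gamma> (t 1)) +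
          (\<Sum>i<Suc N. tsep X (\<gamma> (t (Suc i))) (\<gamma> (t (Suc (Suc i))))))"
    by (intro partition_sum.step) (auto simp: partition_of_def)
  moreover have "t 0 = a" using Suc.prems by (simp add: partition_of_def)
  ultimately show ?case
    by (simp add: sum.lessThan_Suc_shift[of _ "Suc N"] del: sum.lessThan_Suc)
qed

lemma partition_of_partition_sum:
  assumes "partition_sum X \<gamma> a b s"
  shows "\<exists>N t. partition_of a b N t \<and> s = (\<Sum>i<N. tsep X (\<gamma> (t i)) (\<gamma> (t (Suc i))))"
  using assms
proof (induction rule: partition_sum.induct)
  case (single a b)
  then show ?case
    by (intro exI[of _ 1] exI[of _ "\<lambda>i. if i = 0 then a else b"]) (auto simp: partition_of_def)
next
  case (step a b c s)
  then obtain N t where t: "partition_of b c N t"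
    and s: "s = (\<Sum>i<N. tsep X (\<gamma> (t i)) (\<gamma> (t (Suc i))))" by blast
  let ?t = "\<lambda>i. case i of 0 \<Rightarrow> a | Suc j \<Rightarrow> t j"
  have "partition_of a c (Suc N) ?t"
    using t step.hyps(1) by (auto simp: partition_of_def split: nat.split)
  moreover have "tsep X (\<gamma> a) (\<gamma> b) + s = (\<Sum>i<Suc N. tsep X (\<gamma> (?t i)) (\<gamma> (?t (Suc i))))"
    using t unfolding s by (subst sum.lessThan_Suc_shift) (simp add: partition_of_def)
  ultimately show ?case by blast
qed

lemma tau_length_seg_eq_Inf:
  assumes "a < b"
  shows "tau_length_seg X \<gamma> a b = Inf {s. partition_sum X \<gamma> a b s}"
proof -
  have "{(\<Sum>i<N. tsep X (\<gamma> (t i)) (\<gamma> (t (Suc i)))) | N t. partition_of a b N t} =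
        {s. partition_sum X \<gamma> a b s}"
  proof (intro equalityI subsetI)
    fix s assume "s \<in> {(\<Sum>i<N. tsep X (\<gamma> (t i)) (\<gamma> (t (Suc i)))) | N t. partition_of a b N t}"
    then obtain N t where s: "s = (\<Sum>i<N. tsep X (\<gamma> (t i)) (\<gamma> (t (Suc i))))"
      and t: "partition_of a b N t" by blast
    with assms obtain M where "N = Suc M" by (cases N) (auto simp: partition_of_def)
    with s t partition_sum_of_partition show "s \<in> {s. partition_sum X \<gamma> a b s}" by blast
  qed (use partition_of_partition_sum in fastforce)
  then show ?thesis by (simp add: tau_length_seg_def)
qed

lemma tau_length_seg_le_sum: "partition_sum X \<gamma> a b s \<Longrightarrow> tau_length_seg X \<gamma> a b \<le> s"
  using partition_sum_less[of X \<gamma> a b s] by (simp add: tau_length_seg_eq_Inf Inf_lower)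

lemma tau_length_seg_greatest:
  "a < b \<Longrightarrow> (\<And>s. partition_sum X \<gamma> a b s \<Longrightarrow> x \<le> s) \<Longrightarrow> x \<le> tau_length_seg X \<gamma> a b"
  by (auto simp: tau_length_seg_eq_Inf intro: Inf_greatest)

lemma tau_length_seg_le_tsep: "a < b \<Longrightarrow> tau_length_seg X \<gamma> a b \<le> tsep X (\<gamma> a) (\<gamma> b)"
  by (intro tau_length_seg_le_sum partition_sum.single)

lemma partition_sum_cong:
  assumes "partition_sum X \<gamma> a b s" and "\<And>t. t \<in> {a..b} \<Longrightarrow> \<gamma> t = \<eta> t"
  shows "partition_sum X \<eta> a b s"
  using assms
proof (induction rule: partition_sum.induct)
  case (single a b)
  then show ?case using partition_sum.single[of a b X \<eta>] by simp
next
  case (step a b c s)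
  then have "b < c" by (blast dest: partition_sum_less)
  with step show ?case using partition_sum.step[of a b X \<eta> c s] by simp
qed

lemma tau_length_seg_cong:
  assumes "a < b" and "\<And>t. t \<in> {a..b} \<Longrightarrow> \<gamma> t = \<eta> t"
  shows "tau_length_seg X \<gamma> a b = tau_length_seg X \<eta> a b"
proof -
  have "partition_sum X \<gamma> a b s \<longleftrightarrow> partition_sum X \<eta> a b s" for s
    using partition_sum_cong[of X \<gamma> a b s \<eta>] partition_sum_cong[of X \<eta> a b s \<gamma>] assms(2) by auto
  then show ?thesis using assms(1) by (simp add: tau_length_seg_eq_Inf)
qed

lemma reverse_triangle_along:
  assumes "lorentzian_pre_length_space X" and "fd_causal X \<gamma> I"
    and "r \<in> I" "s \<in> I" "t \<in> I" "r < s" "s < t"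
  shows "tsep X (\<gamma> r) (\<gamma> s) + tsep X (\<gamma> s) (\<gamma> t) \<le> tsep X (\<gamma> r) (\<gamma> t)"
  using assms unfolding lorentzian_pre_length_space_def fd_causal_def curve_along_def
  by (meson image_subset_iff)

lemma tsep_mono_along:
  assumes X: "lorentzian_pre_length_space X" and \<gamma>: "fd_causal X \<gamma> I"
    and I: "r \<in> I" "s \<in> I" "r' \<in> I" "s' \<in> I" and le: "r \<le> r'" "r' < s'" "s' \<le> s"
  shows "tsep X (\<gamma> r') (\<gamma> s') \<le> tsep X (\<gamma> r) (\<gamma> s)"
proof -
  have "tsep X (\<gamma> r') (\<gamma> s') \<le> tsep X (\<gamma> r) (\<gamma> s')"
    using reverse_triangle_along[OF X \<gamma>, of r r' s'] I le
    by (cases "r = r'") (auto elim: order_trans[rotated] add_increasing)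
  also have "\<dots> \<le> tsep X (\<gamma> r) (\<gamma> s)"
    using reverse_triangle_along[OF X \<gamma>, of r s' s] I le
    by (cases "s' = s") (auto elim: order_trans[rotated] add_increasing2)
  finally show ?thesis .
qed

text \<open>
  By the reverse triangle inequality, restricting a partition to a shorter interval does not
  increase the sum.  This makes \<open>\<tau>\<close>-length monotone in the interval.
\<close>

lemma partition_sum_cut_left:
  assumes "partition_sum X \<gamma> a c s" and X: "lorentzian_pre_length_space X"
    and \<gamma>: "fd_causal X \<gamma> I" and "{a..c} \<subseteq> I" "a \<le> a'" "a' < c"
  shows "\<exists>s'\<le>s. partition_sum X \<gamma> a' c s'"
  using assms(1,4-)
proof (induction rule: partition_sum.induct)
  case (single a b)
  then have "tsep X (\<gamma> a') (\<gamma> b) \<le> tsep X (\<gamma> a) (\<gamma> b)"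
    by (intro tsep_mono_along[OF X \<gamma>]) auto
  with single show ?case by (blast intro: partition_sum.single)
next
  case (step a b c s)
  have bc: "b < c" using step.hyps(2) by (rule partition_sum_less)
  show ?case
  proof (cases "a' < b")
    case True
    then have "tsep X (\<gamma> a') (\<gamma> b) \<le> tsep X (\<gamma> a) (\<gamma> b)"
      using step bc by (intro tsep_mono_along[OF X \<gamma>]) auto
    with True step.hyps show ?thesis by (blast intro: partition_sum.step add_right_mono)
  next
    case False
    then obtain s' where "s' \<le> s" "partition_sum X \<gamma> a' c s'"
      using step.IH step.prems step.hyps(1) by force
    then show ?thesis by (meson add_increasing zero_le)
  qed
qed

lemma partition_sum_cut_right:
  assumes "partition_sum X \<gamma> a c s" and X: "lorentzian_pre_length_space X"
    and \<gamma>: "fd_causal X \<gamma> I" and "{a..c} \<subseteq> I" "a < c'" "c' \<le> c"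
  shows "\<exists>s'\<le>s. partition_sum X \<gamma> a c' s'"
  using assms(1,4-)
proof (induction rule: partition_sum.induct)
  case (single a b)
  then have "tsep X (\<gamma> a) (\<gamma> c') \<le> tsep X (\<gamma> a) (\<gamma> b)"
    by (intro tsep_mono_along[OF X \<gamma>]) auto
  with single show ?case by (blast intro: partition_sum.single)
next
  case (step a b c s)
  have bc: "b < c" using step.hyps(2) by (rule partition_sum_less)
  show ?case
  proof (cases "b < c'")
    case True
    then obtain s' where "s' \<le> s" "partition_sum X \<gamma> b c' s'"
      using step.IH step.prems step.hyps(1) by force
    with step.hyps(1) show ?thesis by (blast intro: partition_sum.step add_left_mono)
  next
    case False
    then have "tsep X (\<gamma> a) (\<gamma> c') \<le> tsep X (\<gamma> a) (\<gamma> b) + s"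
      using step bc by (intro add_increasing2 tsep_mono_along[OF X \<gamma>]) auto
    with step.prems(2) show ?thesis by (blast intro: partition_sum.single)
  qed
qed

lemma tau_length_seg_mono:
  assumes X: "lorentzian_pre_length_space X" and \<gamma>: "fd_causal X \<gamma> I"
    and I: "{a..b} \<subseteq> I" and le: "a \<le> c" "c < d" "d \<le> b"
  shows "tau_length_seg X \<gamma> c d \<le> tau_length_seg X \<gamma> a b"
proof (rule tau_length_seg_greatest)
  fix s assume "partition_sum X \<gamma> a b s"
  then obtain s1 where "s1 \<le> s" and s1: "partition_sum X \<gamma> c b s1"
    using partition_sum_cut_left[OF _ X \<gamma> I, of s c] le by force
  moreover obtain s2 where "s2 \<le> s1" "partition_sum X \<gamma> c d s2"
    using partition_sum_cut_right[OF s1 X \<gamma>, of d] I le by force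
  ultimately show "tau_length_seg X \<gamma> c d \<le> s"
    using tau_length_seg_le_sum order_trans by metis
qed (use le in auto)

lemma tau_length_compact:
  assumes "lorentzian_pre_length_space X" and "fd_causal X \<gamma> {a..b}" and "a < b"
  shows "tau_length X \<gamma> {a..b} = tau_length_seg X \<gamma> a b"
  unfolding tau_length_def
proof (rule antisym)
  show "Sup {tau_length_seg X \<gamma> c d | c d. c \<in> {a..b} \<and> d \<in> {a..b} \<and> c < d}
          \<le> tau_length_seg X \<gamma> a b"
    using tau_length_seg_mono[OF assms(1,2)] by (intro Sup_least) auto
  show "tau_length_seg X \<gamma> a b
          \<le> Sup {tau_length_seg X \<gamma> c d | c d. c \<in> {a..b} \<and> d \<in> {a..b} \<and> c < d}"
    using assms(3) by - (rule Sup_upper, rule CollectI, rule exI[of _ a], rule exI[of _ b], simp)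
qed

lemma tau_length_le_tsep:
  assumes X: "lorentzian_pre_length_space X" and \<gamma>: "fd_causal X \<gamma> J"
    and ab: "a \<in> J" "b \<in> J" and I: "I \<subseteq> J" "I \<subseteq> {a..b}"
  shows "tau_length X \<gamma> I \<le> tsep X (\<gamma> a) (\<gamma> b)"
  unfolding tau_length_def
proof (rule Sup_least, clarify)
  fix c d assume cd: "c \<in> I" "d \<in> I" "c < d"
  have "tau_length_seg X \<gamma> c d \<le> tsep X (\<gamma> c) (\<gamma> d)"
    using cd(3) by (rule tau_length_seg_le_tsep)
  also have "\<dots> \<le> tsep X (\<gamma> a) (\<gamma> b)"
    using cd I ab by (intro tsep_mono_along[OF X \<gamma>]) auto
  finally show "tau_length_seg X \<gamma> c d \<le> tsep X (\<gamma> a) (\<gamma> b)" .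
qed

lemma partition_sum_append:
  assumes "partition_sum X \<gamma> a b s" and "partition_sum X \<gamma> b c s'"
  shows "partition_sum X \<gamma> a c (s + s')"
  using assms
  by (induction rule: partition_sum.induct) (auto simp: add.assoc intro: partition_sum.intros)

text \<open>
  If a partition sum of a piece were below the time separation of the end points of the piece,
  adding the end points of the whole curve would give a partition sum below the time separation
  that maximality requires.  Finiteness permits the time separations of the remaining pieces
  to be cancelled.
\<close>

lemma maximal_curve_restrict:
  assumes X: "lorentzian_pre_length_space X" and max: "maximal_curve X \<gamma> a b"
    and fin: "tsep X (\<gamma> a) (\<gamma> b) < \<infinity>" and le: "a \<le> c" "c < d" "d \<le> b"
  shows "tsep X (\<gamma> c) (\<gamma> d) \<le> tau_length_seg X \<gamma> c d"
proof -
  have \<gamma>: "fd_causal X \<gamma> {a..b}" and len: "tau_length_seg X \<gamma> a b = tsep X (\<gamma> a) (\<gamma> b)"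
    using max by (auto simp: maximal_curve_def)
  note rev = reverse_triangle_along[OF X \<gamma>] and mono = tsep_mono_along[OF X \<gamma>]
  have sub: "tsep X (\<gamma> r) (\<gamma> s) < \<infinity>" if "a \<le> r" "r < s" "s \<le> b" for r s
    using mono[of a b r s] that fin
    by (meson atLeastAtMost_iff le_less_trans less_imp_le order.trans order_refl)
  \<comment> \<open>Maximality of the initial piece, then of its final piece.\<close>
  have init: "tsep X (\<gamma> a) (\<gamma> d) \<le> s" if "partition_sum X \<gamma> a d s" for s
  proof (cases "d = b")
    case True
    with that tau_length_seg_le_sum len show ?thesis by metis
  next
    case False
    with le have "d < b" by simp
    then have "tsep X (\<gamma> a) (\<gamma> b) \<le> s + tsep X (\<gamma> d) (\<gamma> b)"
      using partition_sum_append[OF that partition_sum.single, of b] tau_length_seg_le_sum len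
      by metis
    moreover have "tsep X (\<gamma> a) (\<gamma> d) + tsep X (\<gamma> d) (\<gamma> b) \<le> tsep X (\<gamma> a) (\<gamma> b)"
      using le \<open>d < b\<close> by (intro rev) auto
    ultimately have "tsep X (\<gamma> a) (\<gamma> d) + tsep X (\<gamma> d) (\<gamma> b) \<le> s + tsep X (\<gamma> d) (\<gamma> b)"
      by (rule order_trans[rotated])
    moreover have "tsep X (\<gamma> d) (\<gamma> b) \<noteq> \<infinity>"
      using sub[of d b] le \<open>d < b\<close> by fastforce
    ultimately show ?thesis
      by (metis add.commute ennreal_add_left_cancel_le)
  qed
  show ?thesis
  proof (rule tau_length_seg_greatest[OF le(2)])
    fix s assume s: "partition_sum X \<gamma> c d s"
    show "tsep X (\<gamma> c) (\<gamma> d) \<le> s"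
    proof (cases "c = a")
      case True
      with s init show ?thesis by simp
    next
      case False
      with le have "a < c" by simp
      then have "tsep X (\<gamma> a) (\<gamma> c) + tsep X (\<gamma> c) (\<gamma> d) \<le> tsep X (\<gamma> a) (\<gamma> d)"
        using le by (intro rev) auto
      also have "\<dots> \<le> tsep X (\<gamma> a) (\<gamma> c) + s"
        using partition_sum.step[OF \<open>a < c\<close> s] by (rule init)
      finally show ?thesis
        using sub[of a c] le \<open>a < c\<close> by (auto simp: ennreal_add_left_cancel_le)
    qed
  qed
qed

section \<open>Continuity of curves\<close>

lemma locally_Lipschitz_curve_near:
  assumes \<gamma>: "locally_Lipschitz_curve X \<gamma> I" and "t \<in> I"
    and V: "openin (ltop X) V" "\<gamma> t \<in> V"
  shows "\<exists>e>0. \<gamma> ` (I \<inter> ball t e) \<subseteq> V"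
proof -
  obtain e where e: "e > 0"
    and L: "Lipschitz_continuous_map (submetric euclidean_metric (I \<inter> ball t e)) (metr X) \<gamma>"
    using \<gamma> \<open>t \<in> I\<close> by (auto simp: locally_Lipschitz_curve_def)
  from L obtain B where B: "B > 0"
    and lip: "\<forall>r\<in>I \<inter> ball t e. \<forall>s\<in>I \<inter> ball t e. mdist (metr X) (\<gamma> r) (\<gamma> s) \<le> B * dist r s"
    and pts: "\<forall>r\<in>I \<inter> ball t e. \<gamma> r \<in> mspace (metr X)"
    unfolding Lipschitz_continuous_map_pos Pi_iff mspace_submetric mdist_submetric
      mspace_euclidean_metric mdist_euclidean_metric Int_UNIV_right by blast
  interpret Metric_space "mspace (metr X)" "mdist (metr X)" by simp
  obtain r where r: "r > 0" "mball (\<gamma> t) r \<subseteq> V"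
    using V by (auto simp: ltop_def mtopology_of_def openin_mtopology)
  have "\<gamma> s \<in> V" if s: "s \<in> I \<inter> ball t (min e (r / B))" for s
  proof -
    have ball: "t \<in> I \<inter> ball t e" "s \<in> I \<inter> ball t e" using s \<open>t \<in> I\<close> e by auto
    then have "mdist (metr X) (\<gamma> t) (\<gamma> s) \<le> B * dist t s" using lip by blast
    also have "\<dots> < r" using s B by (simp add: field_simps)
    finally have "\<gamma> s \<in> mball (\<gamma> t) r" using pts ball by simp
    with r show ?thesis by blast
  qed
  moreover have "0 < min e (r / B)" using e r B by simp
  ultimately show ?thesis by blast
qed

lemma curve_along_cong:
  assumes "curve_along X R \<gamma> I" and eq: "\<And>t. t \<in> I \<Longrightarrow> \<gamma> t = \<eta> t"
  shows "curve_along X R \<eta> I"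
proof -
  have "locally_Lipschitz_curve X \<eta> I"
    unfolding locally_Lipschitz_curve_def
  proof
    fix t assume "t \<in> I"
    then obtain e where "e > 0"
      "Lipschitz_continuous_map (submetric euclidean_metric (I \<inter> ball t e)) (metr X) \<gamma>"
      using assms(1) unfolding curve_along_def locally_Lipschitz_curve_def by blast
    moreover from this have
      "Lipschitz_continuous_map (submetric euclidean_metric (I \<inter> ball t e)) (metr X) \<eta>"
      by (elim Lipschitz_continuous_map_eq) (simp add: eq)
    ultimately show "\<exists>e>0. Lipschitz_continuous_map (submetric euclidean_metric (I \<inter> ball t e)) (metr X) \<eta>"
      by blast
  qed
  moreover have "\<eta> ` I = \<gamma> ` I" using eq by (auto simp: image_iff)
  moreover have "(\<exists>s\<in>I. \<exists>t\<in>I. \<eta> s \<noteq> \<eta> t) \<longleftrightarrow> (\<exists>s\<in>I. \<exists>t\<in>I. \<gamma> s \<noteq> \<gamma> t)"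
    "(\<forall>s\<in>I. \<forall>t\<in>I. s < t \<longrightarrow> R (\<eta> s) (\<eta> t)) \<longleftrightarrow> (\<forall>s\<in>I. \<forall>t\<in>I. s < t \<longrightarrow> R (\<gamma> s) (\<gamma> t))"
    by (simp_all add: eq cong: ball_cong bex_cong)
  ultimately show ?thesis using assms(1) unfolding curve_along_def by simp
qed

lemma curve_along_subset:
  assumes \<gamma>: "curve_along X R \<gamma> J" and I: "I \<subseteq> J" "is_interval I"
    and nonconst: "s \<in> I" "t \<in> I" "\<gamma> s \<noteq> \<gamma> t"
  shows "curve_along X R \<gamma> I"
proof -
  have "locally_Lipschitz_curve X \<gamma> I"
    unfolding locally_Lipschitz_curve_def
  proof
    fix t assume "t \<in> I"
    then obtain e where "e > 0" and
      L: "Lipschitz_continuous_map (submetric euclidean_metric (J \<inter> ball t e)) (metr X) \<gamma>"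
      using \<gamma> I(1) unfolding curve_along_def locally_Lipschitz_curve_def by blast
    moreover have "Lipschitz_continuous_map (submetric euclidean_metric (I \<inter> ball t e)) (metr X) \<gamma>"
      using Lipschitz_continuous_map_from_submetric_mono[OF L, of "I \<inter> ball t e"] I(1) by blast
    ultimately show "\<exists>e>0. Lipschitz_continuous_map (submetric euclidean_metric (I \<inter> ball t e)) (metr X) \<gamma>"
      by blast
  qed
  then show ?thesis using assms unfolding curve_along_def by blast
qed

lemma fd_timelike_imp_causal:
  assumes "lorentzian_pre_length_space X" and "fd_timelike X \<gamma> I"
  shows "fd_causal X \<gamma> I"
proof -
  have "\<forall>x\<in>pts X. \<forall>y\<in>pts X. chron X x y \<longrightarrow> caus X x y"
    using assms(1) unfolding lorentzian_pre_length_space_def causal_space_def by simp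
  then show ?thesis
    using assms(2) unfolding fd_timelike_def fd_causal_def curve_along_def
    by (simp add: image_subset_iff)
qed

text \<open>
  In a chronological loop the reverse triangle inequality lets time separations be added
  indefinitely, which is incompatible with finiteness.
\<close>

lemma no_chronological_loop:
  assumes X: "lorentzian_pre_length_space X" and p: "p \<in> pts X" "q \<in> pts X"
    and chron: "chron X p q" and fin: "tsep X p q < \<infinity>"
  shows "\<not> chron X q p" "p \<noteq> q"
proof -
  have caus: "\<forall>x\<in>pts X. \<forall>y\<in>pts X. chron X x y \<longrightarrow> caus X x y"
    and trans: "transp_on (pts X) (chron X)"
    and rev: "\<forall>x\<in>pts X. \<forall>y\<in>pts X. \<forall>z\<in>pts X. caus X x y \<and> caus X y z \<longrightarrow>
                tsep X x y + tsep X y z \<le> tsep X x z"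
    and pos: "\<forall>x\<in>pts X. \<forall>y\<in>pts X. 0 < tsep X x y \<longleftrightarrow> chron X x y"
    using X unfolding lorentzian_pre_length_space_def causal_space_def by simp_all
  have loop: "\<not> chron X p p"
  proof
    assume pp: "chron X p p"
    then have "tsep X p p + tsep X p q \<le> tsep X p q"
      using caus rev p chron by blast
    then have "tsep X p q + tsep X p p \<le> tsep X p q + 0" by (simp add: add.commute)
    then have "tsep X p p \<le> 0" using fin unfolding ennreal_add_left_cancel_le by auto
    moreover have "0 < tsep X p p" using pos p pp by blast
    ultimately show False by simp
  qed
  then show "p \<noteq> q" using chron by auto
  show "\<not> chron X q p" using loop chron p transp_onD[OF trans] by blast
qed

text \<open>
  Geodesics are tested on small compact subintervals.  At an end point that belongs to \<open>I\<close> the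
  subinterval extends to one side only, so \<open>t\<close> may coincide with \<open>c\<close> or \<open>d\<close>.
\<close>

lemma interval_compact_neighbourhood:
  fixes I :: "real set"
  assumes I: "is_interval I" and uv: "u \<in> I" "v \<in> I" "u < v" and t: "t \<in> I" and e: "e > 0"
  shows "\<exists>c d e'. c < d \<and> t \<in> {c..d} \<and> {c..d} \<subseteq> I \<and> {c..d} \<subseteq> ball t e \<and> 0 < e' \<and>
           I \<inter> ball t e' \<subseteq> {c..d}"
proof -
  have *: "\<exists>c e'. c \<in> I \<and> c \<le> t \<and> t - e < c \<and> 0 < e' \<and> (\<forall>s\<in>I. t - e' < s \<longrightarrow> c \<le> s) \<and>
             ((\<exists>s\<in>I. s < t) \<longrightarrow> c < t)"
  proof (cases "\<exists>s\<in>I. s < t")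
    case True
    then obtain s where s: "s \<in> I" "s < t" by blast
    define c where "c = max s (t - e / 2)"
    have c: "s \<le> c" "t - e / 2 \<le> c" "c < t" using s e by (auto simp: c_def)
    then have "c \<in> I" using mem_is_interval_1_I[OF I s(1) t] by simp
    with c e show ?thesis by - (rule exI[where x = c], rule exI[where x = "t - c"], simp)
  next
    case False
    with t e show ?thesis by - (rule exI[where x = t], rule exI[where x = 1], force)
  qed
  have **: "\<exists>d e'. d \<in> I \<and> t \<le> d \<and> d < t + e \<and> 0 < e' \<and> (\<forall>s\<in>I. s < t + e' \<longrightarrow> s \<le> d) \<and>
             ((\<exists>s\<in>I. t < s) \<longrightarrow> t < d)"
  proof (cases "\<exists>s\<in>I. t < s")
    case True
    then obtain s where s: "s \<in> I" "t < s" by blast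
    define d where "d = min s (t + e / 2)"
    have d: "d \<le> s" "d \<le> t + e / 2" "t < d" using s e by (auto simp: d_def)
    then have "d \<in> I" using mem_is_interval_1_I[OF I t s(1)] by simp
    with d e show ?thesis by - (rule exI[where x = d], rule exI[where x = "d - t"], simp)
  next
    case False
    with t e show ?thesis by - (rule exI[where x = t], rule exI[where x = 1], force)
  qed
  from * obtain c e1 where c: "c \<in> I" "c \<le> t" "t - e < c" "0 < e1"
    "\<forall>s\<in>I. t - e1 < s \<longrightarrow> c \<le> s" "(\<exists>s\<in>I. s < t) \<longrightarrow> c < t" by blast
  from ** obtain d e2 where d: "d \<in> I" "t \<le> d" "d < t + e" "0 < e2"
    "\<forall>s\<in>I. s < t + e2 \<longrightarrow> s \<le> d" "(\<exists>s\<in>I. t < s) \<longrightarrow> t < d" by blast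
  have "c < d"
  proof (cases "u < t")
    case True
    with c(6) uv(1) d(2) show ?thesis by fastforce
  next
    case False
    with uv(3) have "t < v" by simp
    with d(6) uv(2) c(2) show ?thesis by fastforce
  qed
  moreover have "{c..d} \<subseteq> I" using mem_is_interval_1_I[OF I c(1) d(1)] by auto
  moreover have "t \<in> {c..d}" "0 < min e1 e2" using c d by auto
  moreover have "{c..d} \<subseteq> ball t e"
    using c(3) d(3) by (auto simp: dist_real_def abs_less_iff)
  moreover have "I \<inter> ball t (min e1 e2) \<subseteq> {c..d}"
    using c(5) d(5) by (auto simp: dist_real_def abs_less_iff)
  ultimately show ?thesis by blast
qed

section \<open>Extensions\<close>

lemma extension_inj_on:
  assumes "extension_via \<iota> X Y"
  shows "inj_on \<iota> (pts X)"
proof (rule inj_onI)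
  fix x y assume xy: "x \<in> pts X" "y \<in> pts X" "\<iota> x = \<iota> y"
  then have "mdist (metr X) x y = mdist (metr Y) (\<iota> y) (\<iota> y)" "\<iota> y \<in> pts Y"
    using assms unfolding extension_via_def by (metis, blast)
  then have "mdist (metr X) x y = 0"
    using Metric_space.mdist_zero[OF Metric_space_mspace_mdist] by (simp add: pts_def)
  with xy show "x = y"
    using Metric_space.zero[OF Metric_space_mspace_mdist, of x "metr X" y] by (simp add: pts_def)
qed

lemma extension_fd_causal:
  assumes ext: "extension_via \<iota> X Y" and \<eta>: "fd_causal X \<eta> I"
  shows "fd_causal Y (\<iota> \<circ> \<eta>) I"
proof -
  have I: "is_interval I" "\<eta> ` I \<subseteq> pts X" and c: "causal_curve X \<eta> I"
    using \<eta> by (auto simp: fd_causal_def causal_curve_def curve_along_def)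
  then have "causal_curve Y (\<iota> \<circ> \<eta>) I" using ext unfolding extension_via_def by blast
  moreover have "\<forall>s\<in>I. \<forall>t\<in>I. s < t \<longrightarrow> caus Y (\<iota> (\<eta> s)) (\<iota> (\<eta> t))"
    using ext \<eta> I(2) unfolding extension_via_def fd_causal_def curve_along_def
    by (simp add: image_subset_iff)
  ultimately show ?thesis
    by (auto simp: causal_curve_def fd_causal_def curve_along_def)
qed

lemma pullback_fd_timelike:
  assumes Y: "lorentzian_pre_length_space Y" and ext: "extension_via \<iota> X Y"
    and \<sigma>: "\<sigma> ` I \<subseteq> pts X" and \<gamma>: "fd_timelike Y (\<iota> \<circ> \<sigma>) I"
    and fin: "\<And>s t. s \<in> I \<Longrightarrow> t \<in> I \<Longrightarrow> s < t \<Longrightarrow> tsep Y (\<iota> (\<sigma> s)) (\<iota> (\<sigma> t)) < \<infinity>"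
  shows "fd_timelike X \<sigma> I"
proof -
  have I: "is_interval I" using \<gamma> by (auto simp: fd_timelike_def curve_along_def)
  then have "timelike_curve X \<sigma> I"
    using ext \<sigma> \<gamma> unfolding extension_via_def timelike_curve_def by blast
  \<comment> \<open>The extension property does not fix the time orientation; that both orientations occur
    would give a chronological loop.\<close>
  moreover have False if past: "curve_along X (\<lambda>p q. chron X q p) \<sigma> I"
  proof -
    obtain s t where st: "s \<in> I" "t \<in> I" "s < t"
      using \<gamma> unfolding fd_timelike_def curve_along_def by (metis linorder_neqE_linordered_idom)
    then have "chron X (\<sigma> t) (\<sigma> s)" using past by (auto simp: curve_along_def)
    then have "chron Y (\<iota> (\<sigma> t)) (\<iota> (\<sigma> s))"
      using ext \<sigma> st unfolding extension_via_def by blast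
    moreover have "chron Y (\<iota> (\<sigma> s)) (\<iota> (\<sigma> t))" "\<iota> (\<sigma> s) \<in> pts Y" "\<iota> (\<sigma> t) \<in> pts Y"
      using \<gamma> st by (auto simp: fd_timelike_def curve_along_def)
    ultimately show False using no_chronological_loop(1)[OF Y] fin[OF st] by blast
  qed
  ultimately show ?thesis by (auto simp: timelike_curve_def fd_timelike_def)
qed

text \<open>
  Lengths agree in \<open>X\<close> and in the extension.  The length of any competitor is thus bounded by
  the time separation of the extension, and this bound is attained by \<open>\<sigma>\<close>.
\<close>

lemma pullback_length_eq_local_tsep:
  assumes X: "lorentzian_pre_length_space X" and Y: "lorentzian_pre_length_space Y"
    and ext: "extension_via \<iota> X Y"
    and \<Omega>: "localising_nbhd X x \<Omega> \<omega>"
    and \<sigma>: "fd_causal X \<sigma> {c..d}" "\<sigma> ` {c..d} \<subseteq> \<Omega>" and cd: "c < d" "\<sigma> c \<noteq> \<sigma> d"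
    and max: "tsep Y (\<iota> (\<sigma> c)) (\<iota> (\<sigma> d)) \<le> tau_length_seg Y (\<iota> \<circ> \<sigma>) c d"
  shows "tau_length_seg X \<sigma> c d = ennreal (\<omega> (\<sigma> c) (\<sigma> d))"
proof -
  have "\<sigma> c \<in> \<Omega>" "\<sigma> d \<in> \<Omega>" "caus X (\<sigma> c) (\<sigma> d)"
    using \<sigma> cd by (auto simp: fd_causal_def curve_along_def)
  with cd(2) \<Omega> obtain \<eta> a b where \<eta>: "fd_causal_from_to X \<eta> a b (\<sigma> c) (\<sigma> d)"
    and best: "\<forall>\<rho> a' b'. fd_causal_from_to X \<rho> a' b' (\<sigma> c) (\<sigma> d) \<and> \<rho> ` {a'..b'} \<subseteq> \<Omega> \<longrightarrow>
                 tau_length_seg X \<rho> a' b' \<le> tau_length_seg X \<eta> a b"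
    and len: "tau_length_seg X \<eta> a b = ennreal (\<omega> (\<sigma> c) (\<sigma> d))"
    unfolding localising_nbhd_def by metis
  have \<eta>_fd: "fd_causal X \<eta> {a..b}" and ends: "\<eta> a = \<sigma> c" "\<eta> b = \<sigma> d"
    using \<eta> by (auto simp: fd_causal_from_to_def)
  have "a \<le> b" using \<eta>_fd by (force simp: fd_causal_def curve_along_def)
  with ends cd(2) have "a < b" by (auto simp: less_le)
  have same_length: "tau_length X \<rho> J = tau_length Y (\<iota> \<circ> \<rho>) J" if "fd_causal X \<rho> J" for \<rho> J
    using ext that unfolding extension_via_def by blast
  have "tau_length_seg X \<eta> a b = tau_length Y (\<iota> \<circ> \<eta>) {a..b}"
    using tau_length_compact[OF X \<eta>_fd \<open>a < b\<close>] same_length[OF \<eta>_fd] by simp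
  also have "\<dots> \<le> tsep Y ((\<iota> \<circ> \<eta>) a) ((\<iota> \<circ> \<eta>) b)"
    using \<open>a < b\<close> by (intro tau_length_le_tsep[OF Y extension_fd_causal[OF ext \<eta>_fd]]) auto
  also have "\<dots> \<le> tau_length_seg Y (\<iota> \<circ> \<sigma>) c d" using max ends by simp
  also have "\<dots> = tau_length_seg X \<sigma> c d"
    using tau_length_compact[OF X \<sigma>(1) cd(1)] same_length[OF \<sigma>(1)]
      tau_length_compact[OF Y extension_fd_causal[OF ext \<sigma>(1)] cd(1)] by simp
  finally have "tau_length_seg X \<eta> a b \<le> tau_length_seg X \<sigma> c d" .
  moreover have "tau_length_seg X \<sigma> c d \<le> tau_length_seg X \<eta> a b"
    using best \<sigma> by (auto simp: fd_causal_from_to_def)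
  ultimately show ?thesis using len by simp
qed

text \<open>
  The localising neighbourhoods that make \<open>\<sigma>\<close> a geodesic are those of \<open>X\<close>; the extension
  contributes only the maximality of \<open>\<gamma>\<close> on every compact subinterval.
\<close>

lemma pullback_timelike_geodesic:
  assumes X: "lorentzian_pre_length_space X" "localisable X"
    and Y: "lorentzian_pre_length_space Y" and ext: "extension_via \<iota> X Y"
    and \<gamma>: "fd_timelike Y \<gamma> {a..b}" and max: "maximal_curve Y \<gamma> a b"
    and fin: "tsep Y (\<gamma> a) (\<gamma> b) < \<infinity>"
    and I: "is_interval I" "I \<subseteq> {a..b}" "u \<in> I" "v \<in> I" "u < v"
    and \<sigma>: "\<And>t. t \<in> I \<Longrightarrow> \<sigma> t \<in> pts X" "\<And>t. t \<in> I \<Longrightarrow> \<iota> (\<sigma> t) = \<gamma> t"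
  shows "timelike_geodesic X \<sigma> I" "tau_length X \<sigma> I \<noteq> \<infinity>"
proof -
  have \<gamma>_fd: "fd_causal Y \<gamma> {a..b}" using max by (simp add: maximal_curve_def)
  have ab: "a \<in> {a..b}" "b \<in> {a..b}" using I by auto
  have fin': "tsep Y (\<gamma> s) (\<gamma> t) < \<infinity>" if "s \<in> I" "t \<in> I" "s < t" for s t
  proof -
    have "tsep Y (\<gamma> s) (\<gamma> t) \<le> tsep Y (\<gamma> a) (\<gamma> b)"
      using that I(2) ab by (intro tsep_mono_along[OF Y \<gamma>_fd]) auto
    with fin show ?thesis by simp
  qed
  have distinct: "\<gamma> s \<noteq> \<gamma> t" if "s \<in> I" "t \<in> I" "s < t" for s t
  proof -
    have "chron Y (\<gamma> s) (\<gamma> t)" "\<gamma> s \<in> pts Y" "\<gamma> t \<in> pts Y"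
      using \<gamma> that I(2) by (auto simp: fd_timelike_def curve_along_def)
    with no_chronological_loop(2)[OF Y] fin'[OF that] show ?thesis by blast
  qed
  have "curve_along Y (chron Y) \<gamma> I"
    using \<gamma> I distinct[OF I(3-5)] unfolding fd_timelike_def by (blast intro: curve_along_subset)
  then have "fd_timelike Y (\<iota> \<circ> \<sigma>) I"
    unfolding fd_timelike_def by (rule curve_along_cong) (simp add: \<sigma>(2))
  then have tl: "fd_timelike X \<sigma> I"
    using \<sigma> fin' by (intro pullback_fd_timelike[OF Y ext]) auto
  then have fd: "fd_causal X \<sigma> I" by (rule fd_timelike_imp_causal[OF X(1)])
  have geo: "\<exists>\<Omega> \<omega> c d e. localising_nbhd X (\<sigma> t) \<Omega> \<omega> \<and> c < d \<and> t \<in> {c..d} \<and> {c..d} \<subseteq> I \<and>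
      0 < e \<and> I \<inter> ball t e \<subseteq> {c..d} \<and> \<sigma> ` {c..d} \<subseteq> \<Omega> \<and>
      tau_length_seg X \<sigma> c d = ennreal (\<omega> (\<sigma> c) (\<sigma> d))" if t: "t \<in> I" for t
  proof -
    obtain \<Omega> \<omega> where \<Omega>: "localising_nbhd X (\<sigma> t) \<Omega> \<omega>"
      using X(2) \<sigma>(1)[OF t] by (auto simp: localisable_def)
    then obtain e where e: "e > 0" "\<sigma> ` (I \<inter> ball t e) \<subseteq> \<Omega>"
      using locally_Lipschitz_curve_near[OF _ t, of X \<sigma> \<Omega>] fd
      by (auto simp: localising_nbhd_def fd_causal_def curve_along_def)
    obtain c d e' where cd: "c < d" "t \<in> {c..d}" "{c..d} \<subseteq> I" "{c..d} \<subseteq> ball t e"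
      and e': "0 < e'" "I \<inter> ball t e' \<subseteq> {c..d}"
      using interval_compact_neighbourhood[OF I(1,3-5) t e(1)] by blast
    have in_\<Omega>: "\<sigma> ` {c..d} \<subseteq> \<Omega>" using e(2) cd(3,4) by blast
    have cdI: "c \<in> I" "d \<in> I" using cd(1,3) by auto
    have "\<sigma> c \<noteq> \<sigma> d" using distinct[OF cdI cd(1)] \<sigma>(2) cdI by metis
    moreover from this have "fd_causal X \<sigma> {c..d}"
      using fd cd unfolding fd_causal_def
      by (intro curve_along_subset[of X _ \<sigma> I "{c..d}" c d]) (auto simp: is_interval_cc)
    moreover have "tsep Y (\<iota> (\<sigma> c)) (\<iota> (\<sigma> d)) \<le> tau_length_seg Y (\<iota> \<circ> \<sigma>) c d"
    proof -
      have "tau_length_seg Y (\<iota> \<circ> \<sigma>) c d = tau_length_seg Y \<gamma> c d"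
        using cd \<sigma>(2) by (intro tau_length_seg_cong) auto
      moreover have "tsep Y (\<gamma> c) (\<gamma> d) \<le> tau_length_seg Y \<gamma> c d"
        using cdI I(2) cd(1) by (intro maximal_curve_restrict[OF Y max fin]) auto
      ultimately show ?thesis using \<sigma>(2) cdI by simp
    qed
    ultimately have "tau_length_seg X \<sigma> c d = ennreal (\<omega> (\<sigma> c) (\<sigma> d))"
      using pullback_length_eq_local_tsep[OF X(1) Y ext \<Omega> _ in_\<Omega> cd(1)] by blast
    with \<Omega> cd e' in_\<Omega> show ?thesis by blast
  qed
  show "timelike_geodesic X \<sigma> I"
    unfolding timelike_geodesic_def geodesic_def using fd tl geo by blast
  have "tau_length X \<sigma> I = tau_length Y (\<iota> \<circ> \<sigma>) I"
    using ext fd unfolding extension_via_def by blast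
  also have "\<dots> = tau_length Y \<gamma> I"
  proof -
    have "tau_length_seg Y (\<iota> \<circ> \<sigma>) c d = tau_length_seg Y \<gamma> c d"
      if "c \<in> I" "d \<in> I" "c < d" for c d
      using that mem_is_interval_1_I[OF I(1) that(1,2)] \<sigma>(2) by (intro tau_length_seg_cong) auto
    then show ?thesis unfolding tau_length_def by (metis (no_types, lifting))
  qed
  also have "\<dots> \<le> tsep Y (\<gamma> a) (\<gamma> b)"
    by (rule tau_length_le_tsep[OF Y \<gamma>_fd ab I(2) I(2)])
  finally show "tau_length X \<sigma> I \<noteq> \<infinity>" using fin by auto
qed

section \<open>Consequences of (TC)\<close>

text \<open>A reparametrisation of a half-open interval is onto, so it preserves convergence to the end.\<close>

lemma reparam_near_end:
  fixes c d e :: real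
  assumes "c < d" and "e > 0"
  shows "reparam {c..<d} \<phi> \<Longrightarrow> \<exists>t\<in>{c..<d}. dist d t < e \<and> dist d (\<phi> t) < e"
    and "reparam {c<..d} \<phi> \<Longrightarrow> \<exists>t\<in>{c<..d}. dist c t < e \<and> dist c (\<phi> t) < e"
proof -
  assume \<phi>: "reparam {c..<d} \<phi>"
  define s where "s = max c (d - e / 2)"
  have s: "s \<in> {c..<d}" "d - e / 2 \<le> s" using assms by (auto simp: s_def)
  obtain r where r: "r \<in> {c..<d}" "\<phi> r = s" using \<phi> s(1) unfolding reparam_def by (metis imageE)
  define t where "t = max r s"
  have t: "t \<in> {c..<d}" "r \<le> t" "s \<le> t" using r(1) s(1) by (auto simp: t_def)
  have "\<phi> t \<in> {c..<d}" using \<phi> t(1) unfolding reparam_def by blast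
  moreover have "s \<le> \<phi> t"
    using \<phi> r t(1,2) strict_mono_on_leD unfolding reparam_def by blast
  ultimately show "\<exists>t\<in>{c..<d}. dist d t < e \<and> dist d (\<phi> t) < e"
    using s(2) t assms by (intro bexI[OF _ t(1)]) (auto simp: dist_real_def)
next
  assume \<phi>: "reparam {c<..d} \<phi>"
  define s where "s = min d (c + e / 2)"
  have s: "s \<in> {c<..d}" "s \<le> c + e / 2" using assms by (auto simp: s_def)
  obtain r where r: "r \<in> {c<..d}" "\<phi> r = s" using \<phi> s(1) unfolding reparam_def by (metis imageE)
  define t where "t = min r s"
  have t: "t \<in> {c<..d}" "t \<le> r" "t \<le> s" using r(1) s(1) by (auto simp: t_def)
  have "\<phi> t \<in> {c<..d}" using \<phi> t(1) unfolding reparam_def by blast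
  moreover have "\<phi> t \<le> s"
    using \<phi> r t(1,2) strict_mono_on_leD unfolding reparam_def by blast
  ultimately show "\<exists>t\<in>{c<..d}. dist c t < e \<and> dist c (\<phi> t) < e"
    using s(2) t assms by (intro bexI[OF _ t(1)]) (auto simp: dist_real_def)
qed

text \<open>
  Parameters arbitrarily close to \<open>e\<close> have a common value of \<open>\<iota> \<circ> \<rho>\<close> and of \<open>\<gamma> \<circ> \<phi>\<close>; as \<open>\<iota>\<close> is
  isometric, this value is close to both \<open>\<iota> (\<rho> e)\<close> and \<open>\<gamma> e\<close>.
\<close>

lemma extension_preserves_limit:
  assumes ext: "extension_via \<iota> X Y"
    and \<rho>: "locally_Lipschitz_curve X \<rho> J" "e \<in> J" "I \<subseteq> J" "\<rho> ` J \<subseteq> pts X"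
    and \<gamma>: "locally_Lipschitz_curve Y \<gamma> K" "e \<in> K" "I \<subseteq> K" "\<gamma> ` K \<subseteq> pts Y"
    and \<phi>: "\<phi> ` I \<subseteq> I" "\<And>t. t \<in> I \<Longrightarrow> \<iota> (\<rho> t) = \<gamma> (\<phi> t)"
    and near: "\<And>\<epsilon>. \<epsilon> > 0 \<Longrightarrow> \<exists>t\<in>I. dist e t < \<epsilon> \<and> dist e (\<phi> t) < \<epsilon>"
  shows "\<iota> (\<rho> e) = \<gamma> e"
proof (rule ccontr)
  assume ne: "\<iota> (\<rho> e) \<noteq> \<gamma> e"
  interpret X: Metric_space "mspace (metr X)" "mdist (metr X)" by simp
  interpret Y: Metric_space "mspace (metr Y)" "mdist (metr Y)" by simp
  define r where "r = mdist (metr Y) (\<iota> (\<rho> e)) (\<gamma> e)"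
  have pts: "\<rho> e \<in> mspace (metr X)" "\<gamma> e \<in> mspace (metr Y)" "\<iota> (\<rho> e) \<in> mspace (metr Y)"
    using \<rho>(2,4) \<gamma>(2,4) ext unfolding extension_via_def pts_def by blast+
  with ne have r: "r > 0" unfolding r_def using Y.mdist_pos_less by blast
  obtain e1 where e1: "e1 > 0" "\<rho> ` (J \<inter> ball e e1) \<subseteq> X.mball (\<rho> e) (r / 2)"
    using locally_Lipschitz_curve_near[OF \<rho>(1,2), of "X.mball (\<rho> e) (r / 2)"] pts r
    by (auto simp: ltop_def mtopology_of_def)
  obtain e2 where e2: "e2 > 0" "\<gamma> ` (K \<inter> ball e e2) \<subseteq> Y.mball (\<gamma> e) (r / 2)"
    using locally_Lipschitz_curve_near[OF \<gamma>(1,2), of "Y.mball (\<gamma> e) (r / 2)"] pts r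
    by (auto simp: ltop_def mtopology_of_def)
  obtain t where t: "t \<in> I" "dist e t < min e1 e2" "dist e (\<phi> t) < min e1 e2"
    using near[of "min e1 e2"] e1(1) e2(1) by auto
  have "t \<in> J \<inter> ball e e1" using t \<rho>(3) by auto
  then have "\<rho> t \<in> X.mball (\<rho> e) (r / 2)" using e1(2) by blast
  then have "mdist (metr X) (\<rho> e) (\<rho> t) < r / 2" "\<rho> t \<in> mspace (metr X)" by auto
  then have 1: "mdist (metr Y) (\<iota> (\<rho> e)) (\<iota> (\<rho> t)) < r / 2"
    using ext pts unfolding extension_via_def pts_def by simp
  have "\<phi> t \<in> K \<inter> ball e e2" using t \<phi>(1) \<gamma>(3) by auto
  then have "\<gamma> (\<phi> t) \<in> Y.mball (\<gamma> e) (r / 2)" using e2(2) by blast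
  with \<phi>(2)[OF t(1)] have 2: "\<iota> (\<rho> t) \<in> mspace (metr Y)"
    "mdist (metr Y) (\<gamma> e) (\<iota> (\<rho> t)) < r / 2" by auto
  show False
    using Y.triangle[OF pts(3) 2(1) pts(2)] 1 2 unfolding r_def by (simp add: Y.commute)
qed

text \<open>
  The part over \<open>I\<close> is a timelike geodesic of \<open>X\<close> of finite length, so by (TC) it has a limit in
  \<open>X\<close> after a reparametrisation.  The alternatives for \<open>I\<close> and its missing end point \<open>e\<close>
  are a curve that leaves \<open>\<iota>(X)\<close> at \<open>e\<close> and one that enters it there.
\<close>

lemma endpoint_in_image:
  assumes X: "lorentzian_pre_length_space X" "localisable X" and TC: "property_TC X"
    and Y: "lorentzian_pre_length_space Y" and ext: "extension_via \<iota> X Y"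
    and \<gamma>: "fd_timelike Y \<gamma> {a..b}" and max: "maximal_curve Y \<gamma> a b"
    and fin: "tsep Y (\<gamma> a) (\<gamma> b) < \<infinity>"
    and cd: "a \<le> c" "c < d" "d \<le> b"
    and I: "I = {c..<d} \<and> e = d \<or> I = {c<..d} \<and> e = c" and inside: "\<gamma> ` I \<subseteq> \<iota> ` pts X"
  shows "\<gamma> e \<in> \<iota> ` pts X"
proof -
  define \<sigma> where "\<sigma> = inv_into (pts X) \<iota> \<circ> \<gamma>"
  have \<sigma>: "\<sigma> t \<in> pts X" "\<iota> (\<sigma> t) = \<gamma> t" if "t \<in> I" for t
    using that inside by (auto simp: \<sigma>_def inv_into_into f_inv_into_f)
  obtain u v where uv: "u \<in> I" "v \<in> I" "u < v"
  proof -
    have "c < (c + d) / 2" "(c + d) / 2 < d" using cd by auto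
    with I that[of c "(c + d) / 2"] that[of "(c + d) / 2" d] show ?thesis by auto
  qed
  have sub: "is_interval I" "I \<subseteq> {a..b}" using I cd by (auto simp: is_interval_co is_interval_oc)
  have geo: "timelike_geodesic X \<sigma> I" and len: "tau_length X \<sigma> I \<noteq> \<infinity>"
    using pullback_timelike_geodesic[OF X Y ext \<gamma> max fin sub uv \<sigma>] by auto
  obtain \<phi> \<rho> where \<phi>: "reparam I \<phi>" and \<rho>: "geodesic X \<rho> {c..d}"
    and eq: "\<forall>t\<in>I. \<rho> t = \<sigma> (\<phi> t)"
  proof (cases "I = {c..<d}")
    case True
    then obtain \<phi> where "reparam I \<phi>" "future_extendible X (\<sigma> \<circ> \<phi>) c d"
      using TC geo len unfolding property_TC_def by blast
    with True that show ?thesis unfolding future_extendible_def o_def by blast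
  next
    case False
    then have I': "I = {c<..d}" using I by auto
    then obtain \<phi> where "reparam I \<phi>" "past_extendible X (\<sigma> \<circ> \<phi>) c d"
      using TC geo len unfolding property_TC_def by blast
    with I' that show ?thesis unfolding past_extendible_def o_def by blast
  qed
  have \<phi>_in: "\<phi> ` I \<subseteq> I" using \<phi> by (simp add: reparam_def)
  have "\<iota> (\<rho> e) = \<gamma> e"
  proof (rule extension_preserves_limit[OF ext])
    show "locally_Lipschitz_curve X \<rho> {c..d}" "\<rho> ` {c..d} \<subseteq> pts X"
      using \<rho> by (auto simp: geodesic_def fd_causal_def curve_along_def)
    show "locally_Lipschitz_curve Y \<gamma> {a..b}" "\<gamma> ` {a..b} \<subseteq> pts Y"
      using \<gamma> by (auto simp: fd_timelike_def curve_along_def)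
    show "\<iota> (\<rho> t) = \<gamma> (\<phi> t)" if "t \<in> I" for t using that eq \<phi>_in \<sigma>(2) by auto
    show "\<exists>t\<in>I. dist e t < \<epsilon> \<and> dist e (\<phi> t) < \<epsilon>" if "\<epsilon> > 0" for \<epsilon>
      using reparam_near_end[OF cd(2) that] \<phi> I by auto
  qed (use I cd sub \<phi>_in in auto)
  moreover have "\<rho> e \<in> pts X"
    using \<rho> I cd by (auto simp: geodesic_def fd_causal_def curve_along_def)
  ultimately show ?thesis by (metis imageI)
qed

section \<open>Crossing the boundary\<close>

text \<open>
  The exit parameter is the infimum of the parameters outside \<open>V\<close>; it is attained because \<open>V\<close> is
  open and the curve continuous.  Dually, the entry parameter is the supremum.
\<close>

lemma first_exit:
  assumes \<gamma>: "locally_Lipschitz_curve Y \<gamma> {a..b}" and V: "openin (ltop Y) V"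
    and "a \<le> b" "\<gamma> a \<in> V" "\<gamma> b \<notin> V"
  shows "\<exists>d. a < d \<and> d \<le> b \<and> \<gamma> ` {a..<d} \<subseteq> V \<and> \<gamma> d \<notin> V"
proof -
  define T where "T = {t \<in> {a..b}. \<gamma> t \<notin> V}"
  have b: "b \<in> T" using assms by (auto simp: T_def)
  have bdd: "bdd_below T" by (auto simp: T_def)
  define d where "d = Inf T"
  have d: "a \<le> d" "d \<le> b"
    using b bdd by (auto simp: d_def T_def intro!: cInf_lower cInf_greatest)
  have less: "\<gamma> t \<in> V" if "a \<le> t" "t < d" for t
  proof (rule ccontr)
    assume "\<gamma> t \<notin> V"
    with that d have "t \<in> T" by (simp add: T_def)
    then show False using cInf_lower[OF _ bdd, of t] that by (simp add: d_def)
  qed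
  have "\<gamma> d \<notin> V"
  proof
    assume "\<gamma> d \<in> V"
    then obtain e where e: "e > 0" "\<gamma> ` ({a..b} \<inter> ball d e) \<subseteq> V"
      using locally_Lipschitz_curve_near[OF \<gamma> _ V, of d] d by auto
    have "d + e \<le> t" if t: "t \<in> T" for t
    proof (rule ccontr)
      assume "\<not> d + e \<le> t"
      moreover have "d \<le> t" using cInf_lower[OF t bdd] by (simp add: d_def)
      ultimately have "t \<in> {a..b} \<inter> ball d e" using t by (auto simp: T_def dist_real_def)
      with e(2) t show False unfolding T_def by blast
    qed
    then have "d + e \<le> d" unfolding d_def using b by (intro cInf_greatest) auto
    with e show False by simp
  qed
  moreover from this have "a \<noteq> d" using assms by auto
  ultimately show ?thesis using d less by (intro exI[of _ d]) auto
qed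

lemma last_entry:
  assumes \<gamma>: "locally_Lipschitz_curve Y \<gamma> {a..b}" and V: "openin (ltop Y) V"
    and "a \<le> b" "\<gamma> a \<notin> V" "\<gamma> b \<in> V"
  shows "\<exists>c. a \<le> c \<and> c < b \<and> \<gamma> ` {c<..b} \<subseteq> V \<and> \<gamma> c \<notin> V"
proof -
  define T where "T = {t \<in> {a..b}. \<gamma> t \<notin> V}"
  have a: "a \<in> T" using assms by (auto simp: T_def)
  have bdd: "bdd_above T" by (auto simp: T_def)
  define c where "c = Sup T"
  have c: "a \<le> c" "c \<le> b"
    using a bdd by (auto simp: c_def T_def intro!: cSup_upper cSup_least)
  have less: "\<gamma> t \<in> V" if "c < t" "t \<le> b" for t
  proof (rule ccontr)
    assume "\<gamma> t \<notin> V"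
    with that c have "t \<in> T" by (simp add: T_def)
    then show False using cSup_upper[OF _ bdd, of t] that by (simp add: c_def)
  qed
  have "\<gamma> c \<notin> V"
  proof
    assume "\<gamma> c \<in> V"
    then obtain e where e: "e > 0" "\<gamma> ` ({a..b} \<inter> ball c e) \<subseteq> V"
      using locally_Lipschitz_curve_near[OF \<gamma> _ V, of c] c by auto
    have "t \<le> c - e" if t: "t \<in> T" for t
    proof (rule ccontr)
      assume "\<not> t \<le> c - e"
      moreover have "t \<le> c" using cSup_upper[OF t bdd] by (simp add: c_def)
      ultimately have "t \<in> {a..b} \<inter> ball c e" using t by (auto simp: T_def dist_real_def)
      with e(2) t show False unfolding T_def by blast
    qed
    then have "c \<le> c - e" unfolding c_def using a by (intro cSup_least) auto
    with e show False by simp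
  qed
  moreover from this have "c \<noteq> b" using assms by auto
  ultimately show ?thesis using c less by (intro exI[of _ c]) auto
qed

lemma open_chron_past:
  assumes X: "lorentzian_pre_length_space X" and q: "q \<in> pts X"
  shows "openin (ltop X) (chron_past X q)"
proof -
  let ?P = "{(x, y). x \<in> pts X \<and> y \<in> pts X \<and> 0 < tsep X x y}"
  have "openin (prod_topology (ltop X) (ltop X)) ?P"
    using X unfolding lorentzian_pre_length_space_def by blast
  moreover have "continuous_map (ltop X) (prod_topology (ltop X) (ltop X)) (\<lambda>x. (x, q))"
    using q by (simp add: continuous_map_pairwise o_def ltop_def pts_def)
  ultimately have "openin (ltop X) {x \<in> topspace (ltop X). (x, q) \<in> ?P}"
    by (rule openin_continuous_map_preimage[rotated])
  moreover have "{x \<in> topspace (ltop X). (x, q) \<in> ?P} = chron_past X q"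
  proof -
    have "\<forall>x\<in>pts X. \<forall>y\<in>pts X. 0 < tsep X x y \<longleftrightarrow> chron X x y"
      using X unfolding lorentzian_pre_length_space_def by simp
    then show ?thesis using q unfolding chron_past_def by (auto simp: ltop_def pts_def)
  qed
  ultimately show ?thesis by simp
qed

lemma chron_future_near:
  assumes Y: "lorentzian_length_space Y" and V: "openin (ltop Y) V" "p \<in> V"
  shows "\<exists>q\<in>V. chron Y p q"
proof -
  have p: "p \<in> pts Y" using openin_subset[OF V(1)] V(2) by (auto simp: ltop_def pts_def)
  then obtain \<Omega> \<omega> where \<Omega>: "localising_nbhd Y p \<Omega> \<omega>"
    using Y by (auto simp: lorentzian_length_space_def localisable_def)
  then obtain y where y: "chron Y p y" "y \<in> pts Y"
    unfolding localising_nbhd_def chron_future_def by blast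
  obtain \<alpha> a b where \<alpha>: "fd_timelike_from_to Y \<alpha> a b p y"
    using Y p y unfolding lorentzian_length_space_def causally_path_connected_def by blast
  then have \<alpha>': "locally_Lipschitz_curve Y \<alpha> {a..b}" "\<alpha> a = p"
    and nonconst: "\<exists>s\<in>{a..b}. \<exists>t\<in>{a..b}. \<alpha> s \<noteq> \<alpha> t"
    and tl: "\<forall>s\<in>{a..b}. \<forall>t\<in>{a..b}. s < t \<longrightarrow> chron Y (\<alpha> s) (\<alpha> t)"
    unfolding fd_timelike_from_to_def fd_timelike_def curve_along_def by blast+
  have "a < b"
  proof (rule ccontr)
    assume "\<not> a < b"
    then have "s = a" if "s \<in> {a..b}" for s using that by auto
    with nonconst show False by metis
  qed
  obtain e where e: "e > 0" "\<alpha> ` ({a..b} \<inter> ball a e) \<subseteq> V"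
    using locally_Lipschitz_curve_near[OF \<alpha>'(1) _ V(1), of a] \<alpha>'(2) \<open>a < b\<close> V(2) by auto
  define s where "s = min b (a + e / 2)"
  have s: "a < s" "s \<le> b" "s < a + e" using e(1) \<open>a < b\<close> by (auto simp: s_def)
  then have "s \<in> {a..b} \<inter> ball a e" by (auto simp: dist_real_def)
  then have "\<alpha> s \<in> V" using e(2) by blast
  moreover have "chron Y (\<alpha> a) (\<alpha> s)" using tl s by simp
  ultimately show ?thesis using \<alpha>'(2) by blast
qed

lemma open_set_boundary_point:
  assumes "connected_space T" "openin T A" "A \<noteq> {}" "A \<noteq> topspace T"
  obtains p where "p \<in> T closure_of A" "p \<notin> A"
proof -
  have "\<not> closedin T A" using assms by (auto simp: connected_space_clopen_in)
  then show ?thesis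
    using that closure_of_subset_eq[of A T] openin_subset[OF assms(2)] by blast
qed

text \<open>
  A point \<open>q\<close> in the future of the boundary point \<open>p\<close> is also in the future of points of \<open>A\<close>, since
  the past of \<open>q\<close> is open.  If \<open>q\<close> is in \<open>A\<close>, the curve to \<open>q\<close> starts at \<open>p\<close>; otherwise it starts at
  a nearby point of \<open>A\<close>.
\<close>

lemma maximal_curve_meeting_both:
  assumes Y: "lorentzian_length_space Y" and tgc: "locally_timelike_geodesically_connected Y"
    and p: "p \<in> ltop Y closure_of A" "p \<notin> A"
    and U: "neighbourhood Y p U" "\<And>x y. x \<in> U \<Longrightarrow> y \<in> U \<Longrightarrow> tsep Y x y < \<infinity>"
  shows "\<exists>\<gamma> a b. fd_timelike Y \<gamma> {a..b} \<and> maximal_curve Y \<gamma> a b \<and> tsep Y (\<gamma> a) (\<gamma> b) < \<infinity> \<and>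
           (\<gamma> a \<in> A \<longleftrightarrow> \<gamma> b \<notin> A)"
proof -
  have LY: "lorentzian_pre_length_space Y" using Y by (simp add: lorentzian_length_space_def)
  have pY: "p \<in> pts Y"
    using subsetD[OF closure_of_subset_topspace p(1)] by (simp add: ltop_def pts_def)
  obtain W where W: "neighbourhood Y p W" and geo: "\<And>x y. x \<in> W \<Longrightarrow> y \<in> W \<Longrightarrow> chron Y x y \<Longrightarrow>
      \<exists>\<gamma> a b. fd_timelike_from_to Y \<gamma> a b x y \<and> maximal_curve Y \<gamma> a b"
    using tgc pY unfolding locally_timelike_geodesically_connected_def by meson
  obtain U' W' where "openin (ltop Y) U'" "p \<in> U'" "U' \<subseteq> U" "openin (ltop Y) W'" "p \<in> W'" "W' \<subseteq> W"
    using U(1) W unfolding neighbourhood_def by meson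
  then have V: "openin (ltop Y) (U' \<inter> W')" "p \<in> U' \<inter> W'" "U' \<inter> W' \<subseteq> U" "U' \<inter> W' \<subseteq> W"
    by auto
  define V where "V = U' \<inter> W'"
  note V = V[folded V_def]
  obtain q where q: "q \<in> V" "chron Y p q" using chron_future_near[OF Y V(1,2)] by blast
  have qY: "q \<in> pts Y" using q openin_subset[OF V(1)] by (auto simp: ltop_def pts_def)
  have "openin (ltop Y) (V \<inter> chron_past Y q)" "p \<in> V \<inter> chron_past Y q"
    using V(1,2) open_chron_past[OF LY qY] q(2) pY by (auto simp: chron_past_def)
  then obtain x where "x \<in> A" "x \<in> V \<inter> chron_past Y q"
    using p(1) unfolding in_closure_of by blast
  then have x: "x \<in> A" "x \<in> V" "chron Y x q" by (auto simp: chron_past_def)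
  obtain z where z: "z \<in> V" "chron Y z q" "z \<in> A \<longleftrightarrow> q \<notin> A"
    using x p(2) q(2) V(2) by (cases "q \<in> A") blast+
  obtain \<gamma> a b where "fd_timelike_from_to Y \<gamma> a b z q" "maximal_curve Y \<gamma> a b"
    using geo z(1,2) q(1) V(4) by blast
  moreover have "tsep Y z q < \<infinity>" using U(2) z(1) q(1) V(3) by blast
  ultimately show ?thesis using z(3) unfolding fd_timelike_from_to_def by blast
qed

theorem theorem5p4:
  fixes X :: "'a lspace" and Y :: "'b lspace"
  assumes "lorentzian_length_space X"
    and "strongly_causal X"
    and "property_TC X"
    and "is_extension X Y"
    and "lorentzian_length_space Y"
    and "strongly_causal Y"
    and "locally_timelike_geodesically_connected Y"
  shows "\<not> causal_curvature_bounded_above Y"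
proof
  assume "causal_curvature_bounded_above Y"
  then obtain K where K: "causal_curvature_bounded_above_by Y K"
    by (auto simp: causal_curvature_bounded_above_def)
  have X: "lorentzian_pre_length_space X" "localisable X"
    and Y: "lorentzian_pre_length_space Y"
    using assms(1,5) unfolding lorentzian_length_space_def by blast+
  have nonempty: "pts X \<noteq> {}" using X(1) unfolding lorentzian_pre_length_space_def by blast
  obtain \<iota> where ext: "extension_via \<iota> X Y" using assms(4) by (auto simp: is_extension_def)
  let ?A = "\<iota> ` pts X"
  have A: "connected_space (ltop Y)" "openin (ltop Y) ?A" "?A \<noteq> topspace (ltop Y)"
    using ext unfolding extension_via_def by (simp_all add: ltop_def pts_def)
  obtain p where p: "p \<in> ltop Y closure_of ?A" "p \<notin> ?A"
    using open_set_boundary_point[OF A(1,2) _ A(3)] nonempty by blast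
  have "p \<in> pts Y"
    using subsetD[OF closure_of_subset_topspace p(1)] by (simp add: ltop_def pts_def)
  from bspec[OF K[unfolded causal_curvature_bounded_above_by_def] this]
  obtain U where U: "neighbourhood Y p U" "\<forall>x\<in>U. \<forall>y\<in>U. tsep Y x y < \<infinity>"
    by (elim exE conjE) (rule that)
  obtain \<gamma> a b where \<gamma>: "fd_timelike Y \<gamma> {a..b}" "maximal_curve Y \<gamma> a b"
      "tsep Y (\<gamma> a) (\<gamma> b) < \<infinity>" and cross: "\<gamma> a \<in> ?A \<longleftrightarrow> \<gamma> b \<notin> ?A"
    using maximal_curve_meeting_both[OF assms(5,7) p U(1)] U(2) by blast
  have Lip: "locally_Lipschitz_curve Y \<gamma> {a..b}" and "{a..b} \<noteq> {}"
    using \<gamma>(1) unfolding fd_timelike_def curve_along_def by blast+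
  then have ab: "a \<le> b" by simp
  note endpoint = endpoint_in_image[OF X(1,2) assms(3) Y ext \<gamma>]
  show False
  proof (cases "\<gamma> a \<in> ?A")
    case True
    then obtain d where "a < d" "d \<le> b" "\<gamma> ` {a..<d} \<subseteq> ?A" "\<gamma> d \<notin> ?A"
      using first_exit[OF Lip A(2) ab] cross by blast
    with endpoint[of a d "{a..<d}" d] show False by simp
  next
    case False
    then obtain c where "a \<le> c" "c < b" "\<gamma> ` {c<..b} \<subseteq> ?A" "\<gamma> c \<notin> ?A"
      using last_entry[OF Lip A(2) ab] cross by blast
    with endpoint[of c b "{c<..b}" c] show False by simp
  qed
qed

end
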